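(* For any even positive integer $n$, there exists a $4$-dense set of $n$ points in general position in the plane with $n e^{\Omega(\sqrt{\log n})}$ halving lines. Explicitly: there exist constants $c>0$ and $n_0$ such that for every even positive integer $n$ there is a $4$-dense set $P_n\subset\mathbb{R}^2$ of $n$ points in general position such that, whenever $n\ge n_0$, the set $P_n$ has at least $n e^{c\sqrt{\log n}}$ halving lines.
   Context: A set of points in the plane is in general position if no three of its points are on a line. For a set $P$ of $n$ points in the plane, a line determined by two points of $P$ is a halving line of $P$ if it has exactly $(n-2)/2$ points of $P$ on each of its two (open) sides. For $\gamma>0$, a planar set $P$ of $n$ points is $\gamma$-dense if the ratio of the largest and smallest distances determined by (pairs of distinct points of) $P$ is at most $\gamma\sqrt{n}$. *)

theory Defs
  imports "HOL-Analysis.Analysis"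
begin

type_synonym plane = "real ^ 2"

definition general_position :: "plane set \<Rightarrow> bool" where
  "general_position P \<longleftrightarrow>
     (\<forall>p\<in>P. \<forall>q\<in>P. \<forall>r\<in>P. p \<noteq> q \<and> p \<noteq> r \<and> q \<noteq> r \<longrightarrow> \<not> collinear {p, q, r})"

definition pair_distances :: "plane set \<Rightarrow> real set" where
  "pair_distances P = {dist p q | p q. p \<in> P \<and> q \<in> P \<and> p \<noteq> q}"

(* Max and Min are meaningful only for a finite set P with at least two points. *)
definition dense_point_set :: "real \<Rightarrow> plane set \<Rightarrow> bool" where
  "dense_point_set \<gamma> P \<longleftrightarrow>
     finite P \<and>
     Max (pair_distances P) / Min (pair_distances P) \<le> \<gamma> * sqrt (real (card P))"

(* A line is a set of points. The equation a \<bullet> x = b of L is unique up to a nonzero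
   factor, so the two open sides do not depend on its choice. The counts are compared
   in the reals, to avoid truncated subtraction and division. *)
definition halving_line :: "plane set \<Rightarrow> plane set \<Rightarrow> bool" where
  "halving_line P L \<longleftrightarrow>
     (\<exists>p\<in>P. \<exists>q\<in>P. p \<noteq> q \<and> L = affine hull {p, q}) \<and>
     (\<exists>a b. a \<noteq> 0 \<and> L = {x. a \<bullet> x = b} \<and>
        real (card {x \<in> P. a \<bullet> x < b}) = (real (card P) - 2) / 2 \<and>
        real (card {x \<in> P. a \<bullet> x > b}) = (real (card P) - 2) / 2)"

end

theory Submission
  imports Defs
begin

text \<open>
  Idea. Start from two points and the line through them, and iterate the following step. Every point
  is replaced by a cluster of \<open>B\<close> points on a short vertical segment. For an edge \<open>uv\<close> (a halving line)
  the clusters of \<open>u\<close> and \<open>v\<close> contain arithmetic progressions with steps \<open>t e\<close> and \<open>(1 - t) e\<close>, so the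
  lines joining them meet the vertical line through \<open>u + t (v - u)\<close> in equally spaced points. A new
  point \<open>y\<close> placed half-way between two consecutive ones sees each of the \<open>a\<close> points \<open>u\<^sub>i\<close> and \<open>a\<close> points
  \<open>v\<^sub>j\<close> along a line that halves the progressions up to an imbalance of one. A companion \<open>y*\<close> near
  \<open>u - t (v - u)\<close> repairs this imbalance, and the pair \<open>y\<close>, \<open>y*\<close> lies on different sides of every other
  edge line at \<open>u\<close>. So one edge yields \<open>2 a\<close> edges while the number of points grows by the factor
  \<open>B = a + 2 d\<close>, where \<open>d\<close> is the number of edges leaving \<open>u\<close>; with \<open>a = 4 d\<close> the average degree grows
  by \<open>4/3\<close> per step, and after \<open>m\<close> steps there are only \<open>exp (O(m\<^sup>2))\<close> points.

  The step loses only a factor polynomial in \<open>8\<^sup>m\<close> of the vertical perturbation that the halving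
  lines tolerate, so after \<open>m\<close> steps the abscissae can be rounded to integers of size
  \<open>exp (O(m\<^sup>2))\<close> that are distinct modulo the number \<open>N\<close> of points. Affinely flattened copies of the
  resulting set are put on an odd number of equally spaced rays from the origin: every line close to
  one of the rays then halves the remaining copies, and shifting the copies radially by multiples of
  \<open>N\<close> makes the union dense.
\<close>

section \<open>Orientation determinants\<close>

definition orient :: "complex \<Rightarrow> complex \<Rightarrow> complex \<Rightarrow> real" where
  "orient p q r = (Re q - Re p) * (Im r - Im p) - (Re r - Re p) * (Im q - Im p)"

definition x_perimeter :: "complex \<Rightarrow> complex \<Rightarrow> complex \<Rightarrow> real" where
  "x_perimeter p q r = \<bar>Re p - Re q\<bar> + \<bar>Re q - Re r\<bar> + \<bar>Re r - Re p\<bar>"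

text \<open>Affine coordinates along the segment from \<open>u\<close> to \<open>v\<close>. The
  second coordinate is vertical, not perpendicular to the segment, so lifting a point changes only
  \<open>h\<close>.\<close>

definition frame :: "complex \<Rightarrow> complex \<Rightarrow> real \<Rightarrow> real \<Rightarrow> complex" where
  "frame u v l h = u + of_real l * (v - u) + Complex 0 h"

lemma orient_same [simp]: "orient p q p = 0" "orient p q q = 0" "orient p p q = 0"
  by (simp_all add: orient_def algebra_simps)

lemma orient_frame:
  "orient (frame u v l1 h1) (frame u v l2 h2) (frame u v l3 h3) =
     (Re v - Re u) * ((l2 - l1) * (h3 - h1) - (l3 - l1) * (h2 - h1))"
  by (simp add: orient_def frame_def algebra_simps)

lemma orient_frame_base:
  "orient (u + of_real l1 * (v - u)) (u + of_real l2 * (v - u)) q = (l2 - l1) * orient u v q"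
  by (simp add: orient_def algebra_simps)

lemma orient_edge_point:
  "orient u v (w + of_real r * (z - w)) = (1 - r) * orient u v w + r * orient u v z"
  by (simp add: orient_def algebra_simps)

lemma orient_swap: "orient q p r = - orient p q r"
  by (simp add: orient_def algebra_simps)

lemma x_perimeter_swap: "x_perimeter q p r = x_perimeter p q r"
  by (simp add: x_perimeter_def abs_minus_commute)

lemma x_perimeter_nonneg: "0 \<le> x_perimeter p q r" by (simp add: x_perimeter_def)

lemma x_perimeter_shift [simp]:
  "x_perimeter (p + Complex 0 a) (q + Complex 0 b) (r + Complex 0 c) = x_perimeter p q r"
  by (simp add: x_perimeter_def)

text \<open>Shifting one point vertically changes the determinant by the shift times the abscissa
  difference of the other two. No products of shifts arise, because all shifts are parallel.\<close>

lemma orient_shift: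
  assumes "\<bar>a\<bar> \<le> k" "\<bar>b\<bar> \<le> k" "\<bar>c\<bar> \<le> k"
  shows "\<bar>orient (p + Complex 0 a) (q + Complex 0 b) (r + Complex 0 c) - orient p q r\<bar>
    \<le> k * x_perimeter p q r"
proof -
  have "orient (p + Complex 0 a) (q + Complex 0 b) (r + Complex 0 c) - orient p q r
     = a * (Re r - Re q) + b * (Re p - Re r) + c * (Re q - Re p)"
    by (simp add: orient_def algebra_simps)
  also have "\<bar>\<dots>\<bar> \<le> \<bar>a\<bar> * \<bar>Re r - Re q\<bar> + \<bar>b\<bar> * \<bar>Re p - Re r\<bar> + \<bar>c\<bar> * \<bar>Re q - Re p\<bar>"
    unfolding abs_mult [symmetric] by linarith
  also have "\<dots> \<le> k * \<bar>Re r - Re q\<bar> + k * \<bar>Re p - Re r\<bar> + k * \<bar>Re q - Re p\<bar>"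
    using assms by (intro add_mono mult_right_mono) auto
  also have "\<dots> = k * x_perimeter p q r"
    by (simp add: x_perimeter_def algebra_simps abs_minus_commute)
  finally show ?thesis .
qed

lemma abs_convex:
  fixes x y z :: real
  assumes "0 \<le> l" "l \<le> 1"
  shows "\<bar>x + l * (y - x) - z\<bar> \<le> (1 - l) * \<bar>x - z\<bar> + l * \<bar>y - z\<bar>"
proof -
  have "x + l * (y - x) - z = (1 - l) * (x - z) + l * (y - z)" by (simp add: algebra_simps)
  also have "\<bar>\<dots>\<bar> \<le> \<bar>(1 - l) * (x - z)\<bar> + \<bar>l * (y - z)\<bar>" by linarith
  finally show ?thesis using assms by (simp add: abs_mult)
qed

lemma x_perimeter_triangle:
  fixes p q r :: complex
  shows "\<bar>Re p - Re q\<bar> \<le> x_perimeter p q r / 2" "\<bar>Re q - Re r\<bar> \<le> x_perimeter p q r / 2"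
   "\<bar>Re r - Re p\<bar> \<le> x_perimeter p q r / 2"
  by (simp_all add: x_perimeter_def)

lemma x_perimeter_le_spread:
  assumes "\<bar>Re p - Re q\<bar> \<le> m" "\<bar>Re q - Re r\<bar> \<le> m" "\<bar>Re r - Re p\<bar> \<le> m"
  shows "x_perimeter p q r \<le> 2 * m"
  using assms unfolding x_perimeter_def by linarith

text \<open>The perimeter of three numbers is twice their largest distance. By convexity, moving
  \<open>u\<close> and \<open>v\<close> within their segment creates no larger distance.\<close>

lemma x_perimeter_segment:
  assumes "0 \<le> l1" "l1 \<le> 1" "0 \<le> l2" "l2 \<le> 1"
  shows "x_perimeter (u + of_real l1 * (v - u)) (u + of_real l2 * (v - u)) q \<le> x_perimeter u v q"
proof -
  let ?m = "x_perimeter u v q / 2"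
  have seg: "\<bar>Re u + l * (Re v - Re u) - Re q\<bar> \<le> ?m" if "0 \<le> l" "l \<le> 1" for l
  proof -
    have "\<bar>Re u + l * (Re v - Re u) - Re q\<bar> \<le> (1 - l) * \<bar>Re u - Re q\<bar> + l * \<bar>Re v - Re q\<bar>"
      by (rule abs_convex [OF that])
    also have "\<dots> \<le> (1 - l) * ?m + l * ?m"
      using that x_perimeter_triangle(2)[where p=u and q=v and r=q] x_perimeter_triangle(3)[where p=u and q=v and r=q] abs_minus_commute[of "Re q" "Re u"]
      by (intro add_mono mult_left_mono) auto
    also have "\<dots> = ?m" by (simp add: field_simps)
    finally show ?thesis .
  qed
  have "\<bar>(Re u + l1 * (Re v - Re u)) - (Re u + l2 * (Re v - Re u))\<bar> = \<bar>l1 - l2\<bar> * \<bar>Re u - Re v\<bar>"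
    by (simp add: abs_mult [symmetric] algebra_simps)
  also have "\<dots> \<le> 1 * \<bar>Re u - Re v\<bar>" using assms by (intro mult_right_mono) auto
  also have "\<dots> \<le> ?m" using x_perimeter_triangle[where p=u and q=v and r=q] by simp
  finally have m1: "\<bar>(Re u + l1 * (Re v - Re u)) - (Re u + l2 * (Re v - Re u))\<bar> \<le> ?m" .
  have "x_perimeter (u + of_real l1 * (v - u)) (u + of_real l2 * (v - u)) q \<le> 2 * ?m"
    apply (rule x_perimeter_le_spread)
    using m1 seg[OF assms(1,2)] seg[OF assms(3,4)] by (simp_all add: abs_minus_commute)
  thus ?thesis by simp
qed

text \<open>A negative \<open>r\<close> puts the point beyond \<open>u\<close>, seen from
  \<open>z\<close>. This may enlarge the extent, hence the factor 2.\<close>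

lemma x_perimeter_extend:
  assumes "\<bar>r\<bar> \<le> 1"
  shows "x_perimeter u v (u + of_real r * (z - u)) \<le> 2 * x_perimeter u v z"
proof -
  let ?m = "x_perimeter u v z / 2"
  note m = x_perimeter_triangle[where p=u and q=v and r=z]
  have a: "\<bar>r * (Re z - Re u)\<bar> \<le> ?m"
  proof -
    have "\<bar>r * (Re z - Re u)\<bar> \<le> 1 * \<bar>Re z - Re u\<bar>"
      unfolding abs_mult using assms by (intro mult_right_mono) auto
    also have "1 * \<bar>Re z - Re u\<bar> \<le> ?m" using m(3) by simp
    finally show ?thesis .
  qed
  define x where "x = r * (Re z - Re u)"
  have "x_perimeter u v (u + of_real r * (z - u)) = \<bar>Re u - Re v\<bar> + \<bar>Re v - (Re u + x)\<bar> + \<bar>x\<bar>"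
    by (simp add: x_perimeter_def x_def)
  also have "\<dots> \<le> 2 * \<bar>Re u - Re v\<bar> + 2 * \<bar>x\<bar>"
    using abs_triangle_ineq4[of "Re v - Re u" x] by (simp add: abs_minus_commute algebra_simps)
  also have "\<dots> \<le> 2 * x_perimeter u v z" using add_mono[OF a m(1)] by (simp add: x_def)
  finally show ?thesis .
qed

text \<open>Signed counts of a progression seen from its member \<open>i\<close>, or from the gap
  just below \<open>m\<close>. Added over the two ends of an old edge they give the imbalance of one
  that the companion repairs.\<close>

lemma sum_sgn_AP:
  "i < n \<Longrightarrow> (\<Sum>k<n. sgn (real k - real i)) = real n - 1 - 2 * real i"
  "m \<le> n \<Longrightarrow> (\<Sum>k<n. sgn (real k - (real m - 1/2))) = real n - 2 * real m"
proof -
  show "i < n \<Longrightarrow> (\<Sum>k<n. sgn (real k - real i)) = real n - 1 - 2 * real i"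
  proof (induction n)
    case (Suc n)
    show ?case
    proof (cases "i = n")
      case True
      have "(\<Sum>k<n. sgn (real k - real i)) = (\<Sum>k<n. -1)"
        using True by (intro sum.cong) auto
      thus ?thesis using True by simp
    next
      case False
      thus ?thesis using Suc by simp
    qed
  qed simp
  show "m \<le> n \<Longrightarrow> (\<Sum>k<n. sgn (real k - (real m - 1/2))) = real n - 2 * real m"
  proof (induction n)
    case (Suc n)
    show ?case
    proof (cases "m = Suc n")
      case True
      have "(\<Sum>k<Suc n. sgn (real k - (real m - 1/2))) = (\<Sum>k<Suc n. -1)"
        using True by (intro sum.cong) auto
      thus ?thesis using True by simp
    next
      case False
      hence "m \<le> n" using Suc by simp
      moreover from this have "real n - (real m - 1/2) > 0" by linarith
      ultimately show ?thesis using Suc by simp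
    qed
  qed simp
qed


section \<open>The replacement step\<close>

text \<open>
  The edges are the pairs \<open>u\<close>, \<open>nb u c\<close> with \<open>u \<in> A\<close> and \<open>c < d\<close>. In the step, the extra points for
  these edges go near \<open>u\<close>, whence the last assumption: an edge line not through \<open>w \<in> A\<close> must avoid
  the part of every edge at \<open>w\<close> where extra points of this and all later steps will be placed.
  Margins are measured against the perimeter of the abscissae because this is the factor by which
  a vertical perturbation enters a determinant.
\<close>

locale scheme =
  fixes I A :: "nat list set" and nb :: "nat list \<Rightarrow> nat \<Rightarrow> nat list"
    and p :: "nat list \<Rightarrow> complex" and d :: nat and \<mu> \<tau> \<delta> R :: real
  assumes fin: "finite I" and A_sub: "A \<subseteq> I"
    and nb_in: "u \<in> A \<Longrightarrow> c < d \<Longrightarrow> nb u c \<in> I - A"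
    and nb_inj: "u \<in> A \<Longrightarrow> inj_on (nb u) {..<d}"
    and d_pos: "d > 0" and mu_pos: "\<mu> > 0" and mu_le: "\<mu> \<le> 1" and R_ge: "R \<ge> 1" and tau_pos: "\<tau> > 0" and tau_le: "\<tau> \<le> 1/2"
    and delta_pos: "\<delta> > 0"
    and x_sep: "u \<in> A \<Longrightarrow> c < d \<Longrightarrow> \<delta> \<le> \<bar>Re (p (nb u c)) - Re (p u)\<bar>"
    and bound: "w \<in> I \<Longrightarrow> \<bar>Re (p w)\<bar> \<le> R \<and> \<bar>Im (p w)\<bar> \<le> R"
    and balanced: "u \<in> A \<Longrightarrow> c < d \<Longrightarrow> (\<Sum>w\<in>I. sgn (orient (p u) (p (nb u c)) (p w))) = 0"
    and robust0: "\<lbrakk>u \<in> A; c < d; w \<in> I; w \<noteq> u; w \<noteq> nb u c\<rbrakk> \<Longrightarrow>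
       \<mu> * x_perimeter (p u) (p (nb u c)) (p w) \<le> \<bar>orient (p u) (p (nb u c)) (p w)\<bar>"
    and robust: "\<lbrakk>u \<in> A; c < d; w \<in> A; w \<noteq> u; c' < d; \<bar>s\<bar> \<le> \<tau>\<rbrakk> \<Longrightarrow>
       \<mu> * x_perimeter (p u) (p (nb u c)) (p w + of_real s * (p (nb w c') - p w)) \<le>
         sgn (orient (p u) (p (nb u c)) (p w)) *
         orient (p u) (p (nb u c)) (p w + of_real s * (p (nb w c') - p w))"


locale scheme_step = scheme +
  fixes a :: nat
  assumes a_pos: "a > 0"
begin

text \<open>
  Cluster of \<open>w \<in> A\<close>: indices below \<open>a\<close> form the progression, \<open>a + c\<close> is the point \<open>y\<close> for the edge
  \<open>c\<close>, and \<open>a + d + c\<close> its companion \<open>y*\<close>. The point \<open>y\<close> becomes adjacent to the whole progression of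
  \<open>w\<close> and to the middle \<open>a\<close> of the \<open>B\<close> points that replace \<open>nb w c\<close>.
\<close>

definition "B = a + 2 * d"
text \<open>The choice of \<open>t\<close> lets parameters up to \<open>3/2 * t\<close> stay in the
  range where \<open>robust\<close> applies. The step \<open>e\<close> is so small that all heights
  are at most \<open>\<kappa> = t\<^sup>2 * \<mu> / 16\<close>; lifting then costs at most half of a
  margin \<open>t\<^sup>2 * \<mu> / 4\<close>.\<close>

definition "t = \<tau> / 2"
definition "e = t\<^sup>2 * \<mu> / (16 * real B)"
definition "\<kappa> = real B * e"

definition base :: "nat \<Rightarrow> nat list \<Rightarrow> complex" where
  "base k w = (if w \<in> A \<and> a \<le> k then
      (if k < a + d then p w + of_real t * (p (nb w (k - a)) - p w)
       else p w + of_real (- t) * (p (nb w (k - a - d)) - p w))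
    else p w)"

text \<open>A line joining progression points with centred indices \<open>x\<close> at
  \<open>u\<close> and \<open>z\<close> at \<open>v\<close> has height
  \<open>t * (1 - t) * e * (x + z)\<close> at parameter \<open>t\<close>. Here \<open>x + z\<close>
  is an integer because \<open>B - a\<close> is even, so the height of the point y, where
  \<open>x + z\<close> would be 1/2, is half-way between two crossings.\<close>

definition hgt :: "nat \<Rightarrow> nat list \<Rightarrow> real" where
  "hgt k w = (if w \<in> A then
      (if k < a then t * e * (real k - (real a - 1) / 2)
       else if k < a + d then t * (1 - t) * e / 2
       else (real a + 1) * t * e)
    else (1 - t) * e * (real k - (real B - 1) / 2))"

definition p' :: "nat list \<Rightarrow> complex" where
  "p' x = base (hd x) (tl x) + Complex 0 (hgt (hd x) (tl x))"

definition "I' = (\<lambda>(k, w). k # w) ` ({..<B} \<times> I)"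
definition "A' = (\<lambda>(c, u). (a + c) # u) ` ({..<d} \<times> A)"

definition nb' :: "nat list \<Rightarrow> nat \<Rightarrow> nat list" where
  "nb' x j = (if j < a then j # tl x else (d + j - a) # nb (tl x) (hd x - a))"

section \<open>Bounds on the constants and on the heights of the cluster points\<close>

lemma t_pos: "t > 0" and t_le: "t \<le> 1/4"
  using tau_pos tau_le by (simp_all add: t_def)

lemma B_pos: "B > 0" using a_pos by (simp add: B_def)

lemma e_pos: "e > 0" using t_pos mu_pos B_pos by (simp add: e_def)

lemma kappa_eq: "\<kappa> = t\<^sup>2 * \<mu> / 16" using B_pos by (simp add: \<kappa>_def e_def)

lemma e_le_kappa: "real n \<le> real B \<Longrightarrow> real n * e \<le> \<kappa>"
  using e_pos by (simp add: \<kappa>_def)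

lemma te_le: "t * e / 8 \<le> t\<^sup>2 * \<mu> / 8"
proof -
  have "e \<le> \<kappa>" using e_le_kappa[of 1] B_pos by simp
  also have "\<dots> \<le> t\<^sup>2 * \<mu>" using t_pos mu_pos by (simp add: kappa_eq)
  finally have "t * e \<le> 1 * (t\<^sup>2 * \<mu>)" using t_pos t_le e_pos by (intro mult_mono) auto
  thus ?thesis by simp
qed

lemma abs_hgt_le:
  assumes "k < B"
  shows "\<bar>hgt k w\<bar> \<le> \<kappa>"
proof -
  have scaled: "\<bar>f * e * x\<bar> \<le> \<kappa>" if "0 \<le> f" "f \<le> 1" "\<bar>x\<bar> \<le> real B" for f x
  proof -
    have "\<bar>f * e * x\<bar> = f * (\<bar>x\<bar> * e)" using that e_pos by (simp add: abs_mult)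
    also have "\<dots> \<le> 1 * (real B * e)"
      using that e_pos by (intro mult_mono) auto
    finally show ?thesis by (simp add: \<kappa>_def)
  qed
  have "\<bar>real k - (real a - 1) / 2\<bar> \<le> real B" if "k < a"
  proof -
    have "real k + 1 \<le> real a" "real a \<le> real B" using that by (simp_all add: B_def)
    moreover have "real k \<ge> 0" "real a \<ge> 0" by simp_all
    ultimately have "real k - (real a - 1) / 2 \<le> real B" "- (real k - (real a - 1) / 2) \<le> real B"
      by argo+
    thus ?thesis by (rule abs_leI)
  qed
  moreover have "\<bar>real k - (real B - 1) / 2\<bar> \<le> real B"
  proof -
    have "real k + 1 \<le> real B" "real k \<ge> 0" using assms by simp_all
    hence "real k - (real B - 1) / 2 \<le> real B" "- (real k - (real B - 1) / 2) \<le> real B"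
      by argo+
    thus ?thesis by (rule abs_leI)
  qed
  moreover have "\<bar>real a + 1\<bar> \<le> real B" using d_pos by (simp add: B_def)
  moreover have "\<bar>t * (1 - t) * e / 2\<bar> \<le> \<kappa>"
  proof -
    have "t * (1 - t) \<le> 1 * 1" using t_pos t_le by (intro mult_mono) auto
    thus ?thesis
      using scaled[of "t * (1 - t)" "1/2"] B_pos t_pos t_le by simp
  qed
  ultimately show ?thesis
    using scaled[of t "real k - (real a - 1) / 2"] scaled[of "1 - t" "real k - (real B - 1) / 2"]
      scaled[of t "real a + 1", unfolded mult.commute[of "t * e"], folded mult.assoc] t_pos t_le
    unfolding hgt_def by simp
qed

text \<open>
  In the frame of an old edge \<open>uv\<close>, the new edge number \<open>j\<close> starts at abscissa \<open>lamg j\<close> and lies on the graph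
  of \<open>ell j\<close>. It meets the progressions of \<open>u\<close> and \<open>v\<close> at heights \<open>hu j\<close> and \<open>1/2 - hu j\<close>, measured in
  steps; \<open>zu j\<close> and \<open>zv j\<close> below are these positions in terms of the indices.
\<close>

definition lamg :: "nat \<Rightarrow> real" where "lamg j = (if j < a then 0 else 1)"
definition hu :: "nat \<Rightarrow> real" where
  "hu j = (if j < a then real j - (real a - 1) / 2 else 1/2 - (real j - real a - (real a - 1) / 2))"
definition ell :: "nat \<Rightarrow> real \<Rightarrow> real" where
  "ell j l = (1 - l) * (t * e * hu j) + l * ((1 - t) * e * (1/2 - hu j))"

lemma ell_affine: "ell j l = ell j 0 + l * (ell j 1 - ell j 0)"
  by (simp add: ell_def algebra_simps)

lemma lamg_cases: "lamg j = 0 \<or> lamg j = 1" by (simp add: lamg_def)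

lemma t_lamg: "t \<le> \<bar>t - lamg j\<bar>" "\<bar>t - lamg j\<bar> \<le> 1" "t - lamg j \<noteq> 0"
  using t_pos t_le by (auto simp: lamg_def)

text \<open>The terms with \<open>hu j\<close> cancel in \<open>ell j t\<close>, so all lines
  \<open>ell j\<close> pass through the same point y and \<open>j\<close> is arbitrary.\<close>

lemma p'_near:
  assumes "u \<in> A" "c < d"
  shows "p' ((a + c) # u) = frame (p u) (p (nb u c)) t (ell j t)"
  using assms by (simp add: p'_def base_def hgt_def frame_def ell_def field_simps)

lemma p'_nb':
  assumes "u \<in> A" "c < d" "j < 2 * a"
  shows "p' (nb' ((a + c) # u) j) = frame (p u) (p (nb u c)) (lamg j) (ell j (lamg j))"
proof (cases "j < a")
  case True
  thus ?thesis using assms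
    by (simp add: nb'_def p'_def base_def hgt_def frame_def ell_def lamg_def hu_def)
next
  case False
  thus ?thesis using assms nb_in[OF assms(1,2)]
    by (simp add: nb'_def p'_def base_def hgt_def frame_def ell_def lamg_def hu_def B_def
        of_nat_diff field_simps)
qed

text \<open>Both endpoints lie on the graph of the affine function \<open>ell j\<close>, so the
  determinant measures the vertical distance from that graph.\<close>

lemma orient_new_edge:
  assumes "u \<in> A" "c < d" "j < 2 * a"
  shows "orient (p' (nb' ((a + c) # u) j)) (p' ((a + c) # u)) (frame (p u) (p (nb u c)) l h)
    = (Re (p (nb u c)) - Re (p u)) * (t - lamg j) * (h - ell j l)"
proof -
  obtain A C where AC: "\<And>l. ell j l = A + l * C" using ell_affine by blast
  show ?thesis
    unfolding p'_near[OF assms(1,2), of j] p'_nb'[OF assms] orient_frame AC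
    by (simp add: algebra_simps)
qed

section \<open>Margins carried over from old edges to new edges\<close>

lemma ell_bound:
  assumes "u \<in> A" "c < d" "j < 2 * a"
  shows "\<bar>ell j t\<bar> \<le> \<kappa>" "\<bar>ell j (lamg j)\<bar> \<le> \<kappa>"
proof -
  show "\<bar>ell j t\<bar> \<le> \<kappa>"
    using abs_hgt_le[of "a + c" u] assms by (simp add: hgt_def ell_def B_def algebra_simps)
  show "\<bar>ell j (lamg j)\<bar> \<le> \<kappa>"
  proof (cases "j < a")
    case True
    thus ?thesis using abs_hgt_le[of j u] assms
      by (simp add: hgt_def ell_def B_def lamg_def hu_def)
  next
    case False
    thus ?thesis using abs_hgt_le[of "d + j - a" "nb u c"] assms nb_in[OF assms(1,2)]
      by (simp add: hgt_def ell_def B_def lamg_def hu_def of_nat_diff field_simps)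
  qed
qed

text \<open>Here \<open>g\<close>, \<open>y\<close>, \<open>q\<close> are the positions before
  lifting. Heights up to \<open>2 * \<kappa>\<close> consume \<open>t\<^sup>2 * \<mu> / 8\<close> of
  the margin \<open>t\<^sup>2 * \<mu> / 4\<close>, and the other half is at least
  \<open>t * e / 8\<close>.\<close>

lemma margin_lift:
  assumes e: "u \<in> A" "c < d" "j < 2 * a" and s: "\<bar>s\<bar> = 1" and h: "\<bar>h\<bar> \<le> 2 * \<kappa>"
    and g: "g = p u + of_real (lamg j) * (p (nb u c) - p u)"
    and y: "y = p u + of_real t * (p (nb u c) - p u)"
    and M: "t\<^sup>2 * \<mu> / 4 * x_perimeter g y q \<le> s * orient g y q"
  shows "t * e / 8 * x_perimeter (p' (nb' ((a + c) # u) j)) (p' ((a + c) # u)) (q + Complex 0 h)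
     \<le> s * orient (p' (nb' ((a + c) # u) j)) (p' ((a + c) # u)) (q + Complex 0 h)" (is "?L \<le> ?R")
proof -
  have k: "\<kappa> \<ge> 0" using t_pos mu_pos by (simp add: kappa_eq)
  have P: "p' (nb' ((a + c) # u) j) = g + Complex 0 (ell j (lamg j))"
    "p' ((a + c) # u) = y + Complex 0 (ell j t)"
    using p'_near[OF e(1,2), of j] p'_nb'[OF e] by (simp_all add: frame_def g y)
  let ?d = "orient (p' (nb' ((a + c) # u) j)) (p' ((a + c) # u)) (q + Complex 0 h) - orient g y q"
  have "\<bar>?d\<bar> \<le> 2 * \<kappa> * x_perimeter g y q"
    unfolding P using ell_bound[OF e] h k by (intro orient_shift) auto
  hence "\<bar>s * ?d\<bar> \<le> 2 * \<kappa> * x_perimeter g y q" using s by (simp add: abs_mult)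
  hence "s * orient g y q - 2 * \<kappa> * x_perimeter g y q \<le> ?R" by (simp add: algebra_simps)
  moreover have "?L \<le> t\<^sup>2 * \<mu> / 8 * x_perimeter g y q"
    unfolding P x_perimeter_shift by (intro mult_right_mono te_le x_perimeter_nonneg)
  ultimately show ?thesis using M unfolding kappa_eq by (simp add: algebra_simps)
qed


lemma x_diff: "u \<in> A \<Longrightarrow> c < d \<Longrightarrow> Re (p (nb u c)) - Re (p u) \<noteq> 0"
  using x_sep[of u c] delta_pos by auto

lemma x_perimeter_edge_pos: "u \<in> A \<Longrightarrow> c < d \<Longrightarrow> x_perimeter (p u) (p (nb u c)) q > 0"
  using x_diff[of u c] x_perimeter_triangle(1)[where p="p u" and q="p (nb u c)" and r=q] by linarith

lemma sign_old:
  assumes "u \<in> A" "c < d" "w \<in> I" "w \<noteq> u" "w \<noteq> nb u c"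
  shows "\<bar>sgn (orient (p u) (p (nb u c)) (p w))\<bar> = 1"
  using robust0[OF assms] mult_pos_pos[OF mu_pos x_perimeter_edge_pos[OF assms(1,2), of "p w"]]
  by (auto simp: sgn_if)

lemma sgn_mult_self: "sgn x * x = \<bar>x :: real\<bar>" by (simp add: sgn_if)

text \<open>Before lifting, a new edge lies on its old edge. Passing to it scales the determinant by
  \<open>t - lamg j\<close>, of absolute value at least \<open>t\<close>, and does not increase the
  perimeter.\<close>

lemma margin_far:
  assumes "u \<in> A" "c < d" and s: "\<mu> * x_perimeter (p u) (p (nb u c)) q \<le> s * orient (p u) (p (nb u c)) q"
  shows "t\<^sup>2 * \<mu> / 4 * x_perimeter (p u + of_real (lamg j) * (p (nb u c) - p u)) (p u + of_real t * (p (nb u c) - p u)) q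
     \<le> sgn (t - lamg j) * s *
         orient (p u + of_real (lamg j) * (p (nb u c) - p u)) (p u + of_real t * (p (nb u c) - p u)) q"
proof -
  let ?O = "orient (p u) (p (nb u c)) q" and ?X = "x_perimeter (p u) (p (nb u c)) q"
  have "t\<^sup>2 * \<mu> / 4 * x_perimeter (p u + of_real (lamg j) * (p (nb u c) - p u)) (p u + of_real t * (p (nb u c) - p u)) q
      \<le> t * \<mu> * ?X"
  proof (intro mult_mono x_perimeter_segment x_perimeter_nonneg)
    have "t * (t * \<mu>) \<le> 4 * (t * \<mu>)" using t_le t_pos mu_pos by (intro mult_right_mono) auto
    thus "t\<^sup>2 * \<mu> / 4 \<le> t * \<mu>" by (simp add: power2_eq_square)
  qed (use t_pos t_le mu_pos lamg_cases[of j] in auto)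
  also have "\<dots> \<le> \<bar>t - lamg j\<bar> * (s * ?O)"
    unfolding mult.assoc
    using t_lamg(1)[of j] s t_pos mult_nonneg_nonneg[OF less_imp_le[OF mu_pos] x_perimeter_nonneg]
    by (intro mult_mono[of t _ "\<mu> * ?X"]) auto
  also have "\<dots> = (sgn (t - lamg j) * s) * ((t - lamg j) * ?O)"
    by (simp add: sgn_mult_self [symmetric] mult_ac)
  finally show ?thesis by (simp add: orient_frame_base)
qed

text \<open>For a point on the line of another old edge at \<open>u\<close>, the determinant is
  \<open>r\<close> times that of the far end. Its sign therefore flips with \<open>r\<close>, which
  is what puts the points at parameters \<open>t\<close> and \<open>- t\<close> on different
  sides.\<close>

lemma margin_near:
  assumes u: "u \<in> A" "c < d" "c' < d" "c' \<noteq> c" and r: "t / 2 \<le> \<bar>r\<bar>" "\<bar>r\<bar> \<le> 1"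
  defines "q \<equiv> p u + of_real r * (p (nb u c') - p u)"
  shows "t\<^sup>2 * \<mu> / 4 * x_perimeter (p u + of_real (lamg j) * (p (nb u c) - p u)) (p u + of_real t * (p (nb u c) - p u)) q
     \<le> sgn (t - lamg j) * (sgn r * sgn (orient (p u) (p (nb u c)) (p (nb u c')))) *
         orient (p u + of_real (lamg j) * (p (nb u c) - p u)) (p u + of_real t * (p (nb u c) - p u)) q"
proof -
  let ?z = "p (nb u c')"
  let ?O = "orient (p u) (p (nb u c)) ?z" and ?X = "x_perimeter (p u) (p (nb u c)) ?z"
  have z: "nb u c' \<in> I" "nb u c' \<noteq> u" "nb u c' \<noteq> nb u c"
    using nb_in[of u c'] u inj_onD[OF nb_inj[of u], of c' c] by auto
  have "x_perimeter (p u + of_real (lamg j) * (p (nb u c) - p u)) (p u + of_real t * (p (nb u c) - p u)) q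
     \<le> x_perimeter (p u) (p (nb u c)) q"
    using t_pos t_le lamg_cases[of j] by (intro x_perimeter_segment) auto
  also have "\<dots> \<le> 2 * ?X" unfolding q_def by (rule x_perimeter_extend [OF r(2)])
  finally have "t\<^sup>2 * \<mu> / 4 * x_perimeter (p u + of_real (lamg j) * (p (nb u c) - p u)) (p u + of_real t * (p (nb u c) - p u)) q
      \<le> t\<^sup>2 * \<mu> / 4 * (2 * ?X)"
    using mu_pos by (intro mult_left_mono) auto
  also have "\<dots> = t * (t / 2 * (\<mu> * ?X))" by (simp add: power2_eq_square)
  also have "\<dots> \<le> \<bar>t - lamg j\<bar> * (\<bar>r\<bar> * \<bar>?O\<bar>)"
    using t_lamg[of j] t_pos mu_pos x_perimeter_nonneg r robust0[OF u(1,2) z]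
    by (intro mult_mono mult_nonneg_nonneg) auto
  also have "\<dots> = sgn (t - lamg j) * (sgn r * sgn ?O) * ((t - lamg j) * (r * ?O))"
    by (simp add: sgn_mult_self [symmetric] mult_ac)
  also have "(t - lamg j) * (r * ?O) =
     orient (p u + of_real (lamg j) * (p (nb u c) - p u)) (p u + of_real t * (p (nb u c) - p u)) q"
    unfolding orient_frame_base q_def orient_edge_point by simp
  finally show ?thesis .
qed

lemma x_perimeter_new_pos:
  assumes "u \<in> A" "c < d" "j < 2 * a"
  shows "x_perimeter (p' (nb' ((a + c) # u) j)) (p' ((a + c) # u)) q > 0"
proof -
  have "Re (p' (nb' ((a + c) # u) j)) - Re (p' ((a + c) # u)) = (lamg j - t) * (Re (p (nb u c)) - Re (p u))"
    unfolding p'_near[OF assms(1,2), of j] p'_nb'[OF assms] by (simp add: frame_def algebra_simps)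
  hence "Re (p' (nb' ((a + c) # u) j)) - Re (p' ((a + c) # u)) \<noteq> 0"
    using t_lamg[of j] x_diff[OF assms(1,2)] by simp
  thus ?thesis
    using x_perimeter_triangle(1)[where p="p' (nb' ((a + c) # u) j)" and q="p' ((a + c) # u)" and r=q]
    by linarith
qed

lemma sgn_of_margin:
  assumes e: "u \<in> A" "c < d" "j < 2 * a" and s: "\<bar>s\<bar> = 1"
   and le: "t * e / 8 * x_perimeter (p' (nb' ((a + c) # u) j)) (p' ((a + c) # u)) q
     \<le> s * orient (p' (nb' ((a + c) # u) j)) (p' ((a + c) # u)) q"
  shows "sgn (orient (p' (nb' ((a + c) # u) j)) (p' ((a + c) # u)) q) = s"
proof -
  have "0 < t * e / 8 * x_perimeter (p' (nb' ((a + c) # u) j)) (p' ((a + c) # u)) q"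
    using t_pos e_pos x_perimeter_new_pos[OF e] by simp
  hence "0 < s * orient (p' (nb' ((a + c) # u) j)) (p' ((a + c) # u)) q" using le by linarith
  moreover have "s = 1 \<or> s = -1" using s by linarith
  ultimately show ?thesis by auto
qed

text \<open>For points in the frame of the old edge itself no old margin exists. The vertical
  distance from \<open>ell j\<close> replaces it, compared with the spread \<open>m\<close> of the
  three parameters.\<close>

lemma margin_frame:
  assumes e: "u \<in> A" "c < d" "j < 2 * a"
    and m: "\<bar>lamg j - t\<bar> \<le> m" "\<bar>t - l\<bar> \<le> m" "\<bar>l - lamg j\<bar> \<le> m"
    and le: "t * e / 4 * m \<le> \<bar>t - lamg j\<bar> * \<bar>h - ell j l\<bar>"
  shows "t * e / 8 * x_perimeter (p' (nb' ((a + c) # u) j)) (p' ((a + c) # u)) (frame (p u) (p (nb u c)) l h)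
     \<le> \<bar>orient (p' (nb' ((a + c) # u) j)) (p' ((a + c) # u)) (frame (p u) (p (nb u c)) l h)\<bar>"
proof -
  let ?x = "Re (p (nb u c)) - Re (p u)"
  have bnd: "\<bar>(Re (p u) + l1 * ?x) - (Re (p u) + l2 * ?x)\<bar> \<le> m * \<bar>?x\<bar>" if "\<bar>l1 - l2\<bar> \<le> m" for l1 l2
  proof -
    have "(Re (p u) + l1 * ?x) - (Re (p u) + l2 * ?x) = (l1 - l2) * ?x" by (simp add: algebra_simps)
    thus ?thesis using that by (simp add: abs_mult mult_right_mono)
  qed
  have "x_perimeter (p' (nb' ((a + c) # u) j)) (p' ((a + c) # u)) (frame (p u) (p (nb u c)) l h) \<le> 2 * (m * \<bar>?x\<bar>)"
    unfolding p'_near[OF e(1,2), of j] p'_nb'[OF e]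
    apply (rule x_perimeter_le_spread)
    using bnd[OF m(1)] bnd[OF m(2)] bnd[OF m(3)] by (simp_all add: frame_def)
  hence "t * e / 8 * x_perimeter (p' (nb' ((a + c) # u) j)) (p' ((a + c) # u)) (frame (p u) (p (nb u c)) l h)
     \<le> t * e / 8 * (2 * (m * \<bar>?x\<bar>))"
    using t_pos e_pos by (intro mult_left_mono) auto
  also have "\<dots> = (t * e / 4 * m) * \<bar>?x\<bar>" by simp
  also have "\<dots> \<le> (\<bar>t - lamg j\<bar> * \<bar>h - ell j l\<bar>) * \<bar>?x\<bar>" by (intro mult_right_mono le) auto
  also have "\<dots> = \<bar>orient (p' (nb' ((a + c) # u) j)) (p' ((a + c) # u)) (frame (p u) (p (nb u c)) l h)\<bar>"
    unfolding orient_new_edge[OF e] by (simp add: abs_mult mult_ac)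
  finally show ?thesis .
qed

section \<open>Crossings of the new edges with the progressions\<close>

definition zu :: "nat \<Rightarrow> real" where "zu j = (if j < a then real j else real (2 * a - j) - 1/2)"
definition zv :: "nat \<Rightarrow> real" where "zv j = (if j < a then real (a + d - j) - 1/2 else real (j - a + d))"

lemma ell0: "j < 2 * a \<Longrightarrow> t * e * (real k - (real a - 1) / 2) - ell j 0 = t * e * (real k - zu j)"
  by (simp add: ell_def hu_def zu_def of_nat_diff field_simps)

lemma ell1: "j < 2 * a \<Longrightarrow> (1 - t) * e * (real k - (real B - 1) / 2) - ell j 1 = (1 - t) * e * (real k - zv j)"
  by (simp add: ell_def hu_def zv_def B_def of_nat_diff field_simps)

text \<open>Since \<open>hu j \<le> a / 2\<close>, every line \<open>ell j\<close> is at height at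
  most \<open>a * t * e\<close> at parameter \<open>- t\<close>. The companion at height
  \<open>(a + 1) * t * e\<close> thus lies above all new edges of its own old edge.\<close>

lemma ell_star: "j < 2 * a \<Longrightarrow> t * e \<le> (real a + 1) * t * e - ell j (- t)"
proof -
  assume j: "j < 2 * a"
  have "hu j \<le> real a / 2" using j by (auto simp: hu_def field_simps)
  hence "2 * hu j - (1 - t) / 2 \<le> real a"
    using divide_nonneg_pos[of "1 - t" 2] t_le by linarith
  hence "t * e * (2 * hu j - (1 - t) / 2) \<le> t * e * real a"
    using t_pos e_pos by (intro mult_left_mono) auto
  moreover have "ell j (- t) = t * e * (2 * hu j - (1 - t) / 2)"
    by (simp add: ell_def field_simps)
  ultimately show ?thesis by (simp add: algebra_simps)
qed


section \<open>Sides and margins of the new points with respect to a new edge\<close>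

lemma base_far:
  assumes e: "u \<in> A" "c < d" and w: "w \<in> I" "w \<noteq> u" "w \<noteq> nb u c" and k: "k < B"
  shows "\<mu> * x_perimeter (p u) (p (nb u c)) (base k w) \<le>
    sgn (orient (p u) (p (nb u c)) (p w)) * orient (p u) (p (nb u c)) (base k w)"
proof (cases "w \<in> A \<and> a \<le> k")
  case True
  have tt: "\<bar>t\<bar> \<le> \<tau>" "\<bar>- t\<bar> \<le> \<tau>" using t_pos tau_pos by (simp_all add: t_def)
  show ?thesis
  proof (cases "k < a + d")
    case c: True
    hence "k - a < d" using True by auto
    thus ?thesis using c robust[OF e, of w "k - a" t] True w tt by (simp add: base_def)
  next
    case c: False
    hence "k - a - d < d" using k by (simp add: B_def)
    thus ?thesis using robust[OF e, of w "k - a - d" "- t"] True w tt c by (simp add: base_def)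
  qed
next
  case False
  hence "base k w = p w" by (auto simp: base_def)
  thus ?thesis using robust0[OF e w] by (simp add: sgn_mult_self)
qed

text \<open>A whole cluster stays on the side of its old point \<open>w\<close>: even its extra
  points are covered by \<open>robust\<close>. The factor \<open>sgn (t - lamg j)\<close> records
  the direction of the new edge along the old one.\<close>

lemma new_far:
  assumes e: "u \<in> A" "c < d" "j < 2 * a" and w: "w \<in> I" "w \<noteq> u" "w \<noteq> nb u c" and k: "k < B"
  defines "s \<equiv> sgn (t - lamg j) * sgn (orient (p u) (p (nb u c)) (p w))"
  shows "t * e / 8 * x_perimeter (p' (nb' ((a + c) # u) j)) (p' ((a + c) # u)) (p' (k # w))
      \<le> s * orient (p' (nb' ((a + c) # u) j)) (p' ((a + c) # u)) (p' (k # w))" (is ?good)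
    and "sgn (orient (p' (nb' ((a + c) # u) j)) (p' ((a + c) # u)) (p' (k # w))) = s"
proof -
  have s: "\<bar>s\<bar> = 1" using sign_old[OF e(1,2) w] t_lamg(3)[of j] by (simp add: s_def abs_mult sgn_if)
  have h: "\<bar>hgt k w\<bar> \<le> 2 * \<kappa>" using abs_hgt_le[OF k, of w] by linarith
  show ?good
    using margin_lift[OF e s h refl refl margin_far[OF e(1,2) base_far[OF e(1,2) w k], of j, folded s_def]]
    by (simp add: p'_def)
  thus "sgn (orient (p' (nb' ((a + c) # u) j)) (p' ((a + c) # u)) (p' (k # w))) = s"
    by (rule sgn_of_margin[OF e s])
qed

text \<open>Covers the extra points of the other old edges at \<open>u\<close>, and also points
  slightly further along the new edges that start there; hence the range of \<open>r\<close> and the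
  bound \<open>2 * \<kappa>\<close> on the height.\<close>

lemma new_near:
  assumes e: "u \<in> A" "c < d" "j < 2 * a" and c': "c' < d" "c' \<noteq> c"
    and r: "t / 2 \<le> \<bar>r\<bar>" "\<bar>r\<bar> \<le> 1" and h: "\<bar>h\<bar> \<le> 2 * \<kappa>"
  defines "s \<equiv> sgn (t - lamg j) * (sgn r * sgn (orient (p u) (p (nb u c)) (p (nb u c'))))"
    and "q \<equiv> frame (p u) (p (nb u c')) r h"
  shows "t * e / 8 * x_perimeter (p' (nb' ((a + c) # u) j)) (p' ((a + c) # u)) q
      \<le> s * orient (p' (nb' ((a + c) # u) j)) (p' ((a + c) # u)) q" (is ?good)
    and "sgn (orient (p' (nb' ((a + c) # u) j)) (p' ((a + c) # u)) q) = s"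
    and "t * e / 8 * x_perimeter (p' (nb' ((a + c) # u) j)) (p' ((a + c) # u)) q
      \<le> \<bar>orient (p' (nb' ((a + c) # u) j)) (p' ((a + c) # u)) q\<bar>"
proof -
  have z: "nb u c' \<in> I" "nb u c' \<noteq> u" "nb u c' \<noteq> nb u c"
    using nb_in[of u c'] e c' inj_onD[OF nb_inj[of u], of c' c] by auto
  have "r \<noteq> 0" using r t_pos by auto
  hence s: "\<bar>s\<bar> = 1" using sign_old[OF e(1,2) z] t_lamg(3)[of j] by (simp add: s_def abs_mult sgn_if)
  show ?good
    using margin_lift[OF e s h refl refl margin_near[OF e(1,2) c' r, of j, folded s_def]]
    by (simp add: q_def frame_def)
  thus sg: "sgn (orient (p' (nb' ((a + c) # u) j)) (p' ((a + c) # u)) q) = s"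
    by (rule sgn_of_margin[OF e s])
  show "t * e / 8 * x_perimeter (p' (nb' ((a + c) # u) j)) (p' ((a + c) # u)) q
      \<le> \<bar>orient (p' (nb' ((a + c) # u) j)) (p' ((a + c) # u)) q\<bar>"
    using \<open>?good\<close> unfolding sg [symmetric] sgn_mult_self .
qed

lemma p'_frame_u:
  assumes "u \<in> A" "k < B"
  shows "k < a \<Longrightarrow> p' (k # u) = frame (p u) v 0 (t * e * (real k - (real a - 1) / 2))"
    and "c' < d \<Longrightarrow> p' ((a + c') # u) = frame (p u) (p (nb u c')) t (hgt (a + c') u)"
    and "c' < d \<Longrightarrow> p' ((a + d + c') # u) = frame (p u) (p (nb u c')) (- t) ((real a + 1) * t * e)"
  using assms by (simp_all add: p'_def base_def hgt_def frame_def)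

lemma p'_frame_v:
  assumes "v \<notin> A"
  shows "p' (k # v) = frame q (p v) 1 ((1 - t) * e * (real k - (real B - 1) / 2))"
  using assms by (simp add: p'_def base_def hgt_def frame_def)

lemma abs_diff_half: "\<bar>real k - (real m - 1/2)\<bar> \<ge> 1/2"
  by (cases "k < m") auto

text \<open>An edge with \<open>j < a\<close> passes through a member of the progression of
  \<open>u\<close>, so other members are a full step away. The remaining edges cross in a
  gap.\<close>

lemma zu_gap: "k \<noteq> j \<or> a \<le> j \<Longrightarrow> 1/2 \<le> \<bar>real k - zu j\<bar> \<and> (j < a \<longrightarrow> 1 \<le> \<bar>real k - zu j\<bar>)"
proof (cases "j < a")
  case True
  assume "k \<noteq> j \<or> a \<le> j"
  hence "k < j \<or> k > j" using True by auto
  thus ?thesis using True by (auto simp: zu_def)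
qed (use abs_diff_half[of k "2 * a - j"] in \<open>simp add: zu_def\<close>)

lemma zv_gap: "k + a \<noteq> j + d \<or> j < a \<Longrightarrow> 1/2 \<le> \<bar>real k - zv j\<bar>"
proof (cases "j < a")
  case True
  thus ?thesis using abs_diff_half[of k "a + d - j"] by (simp add: zv_def)
next
  case False
  assume "k + a \<noteq> j + d \<or> j < a"
  hence "k \<noteq> j - a + d" using False by auto
  hence "k + 1 \<le> j - a + d \<or> k \<ge> j - a + d + 1" by auto
  hence "real k + 1 \<le> real (j - a + d) \<or> real k \<ge> real (j - a + d) + 1"
    by (metis of_nat_1 of_nat_add of_nat_le_iff)
  thus ?thesis using False unfolding zv_def by auto
qed

lemma new_AP_u:
  assumes e: "u \<in> A" "c < d" "j < 2 * a" and k: "k < a" "k # u \<noteq> nb' ((a + c) # u) j"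
  shows "t * e / 8 * x_perimeter (p' (nb' ((a + c) # u) j)) (p' ((a + c) # u)) (p' (k # u))
     \<le> \<bar>orient (p' (nb' ((a + c) # u) j)) (p' ((a + c) # u)) (p' (k # u))\<bar>"
proof -
  have kB: "k < B" using k by (simp add: B_def)
  have "k \<noteq> j \<or> a \<le> j" using k by (auto simp: nb'_def split: if_splits)
  note gap = zu_gap[OF this]
  \<comment> \<open>The spread of the parameters 0, \<open>t\<close> and \<open>lamg j\<close>. For
    \<open>j < a\<close> it is only \<open>t\<close>, which matches the small factor
    \<open>\<bar>t - lamg j\<bar> = t\<close> on the right.\<close>
  define m where "m = max t (lamg j)"
  have "t * e / 4 * m \<le> \<bar>t - lamg j\<bar> * (t * e * \<bar>real k - zu j\<bar>)"
  proof -
    have "m / 4 \<le> \<bar>t - lamg j\<bar> * \<bar>real k - zu j\<bar>"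
    proof (cases "j < a")
      case True
      have "t * 1 \<le> t * \<bar>real k - zu j\<bar>" using gap True t_pos by (intro mult_left_mono) auto
      thus ?thesis using True t_pos by (simp add: m_def lamg_def)
    next
      case False
      have "(1 - t) * (1/2) \<le> (1 - t) * \<bar>real k - zu j\<bar>" using gap t_le by (intro mult_left_mono) auto
      moreover have "1/4 \<le> (1 - t) * (1/2)" using t_le by simp
      moreover have "m = 1" "\<bar>t - lamg j\<bar> = 1 - t" using False t_pos t_le by (auto simp: m_def lamg_def)
      ultimately show ?thesis by (metis (no_types) order_trans)
    qed
    hence "t * e * (m / 4) \<le> t * e * (\<bar>t - lamg j\<bar> * \<bar>real k - zu j\<bar>)"
      using t_pos e_pos by (intro mult_left_mono) auto
    thus ?thesis by (simp add: mult_ac)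
  qed
  also have "t * e * \<bar>real k - zu j\<bar> = \<bar>t * e * (real k - (real a - 1) / 2) - ell j 0\<bar>"
    unfolding ell0[OF e(3)] using t_pos e_pos by (simp add: abs_mult)
  finally show ?thesis unfolding p'_frame_u(1)[OF e(1) kB k(1), of "p (nb u c)"]
    by (intro margin_frame[OF e, of m]) (use t_pos t_le in \<open>auto simp: m_def lamg_def\<close>)
qed

lemma new_AP_v:
  assumes e: "u \<in> A" "c < d" "j < 2 * a" and k: "k # nb u c \<noteq> nb' ((a + c) # u) j"
  shows "t * e / 8 * x_perimeter (p' (nb' ((a + c) # u) j)) (p' ((a + c) # u)) (p' (k # nb u c))
     \<le> \<bar>orient (p' (nb' ((a + c) # u) j)) (p' ((a + c) # u)) (p' (k # nb u c))\<bar>"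
proof -
  have "k + a \<noteq> j + d \<or> j < a" using k by (auto simp: nb'_def split: if_splits)
  note gap = zv_gap[OF this]
  have "t * e / 4 * 1 \<le> \<bar>t - lamg j\<bar> * ((1 - t) * e * \<bar>real k - zv j\<bar>)"
  proof -
    have "t * ((1/2) * e * (1/2)) \<le> \<bar>t - lamg j\<bar> * ((1 - t) * e * \<bar>real k - zv j\<bar>)"
      using gap t_lamg[of j] t_pos t_le e_pos by (intro mult_mono) auto
    thus ?thesis by simp
  qed
  also have "(1 - t) * e * \<bar>real k - zv j\<bar> = \<bar>(1 - t) * e * (real k - (real B - 1) / 2) - ell j 1\<bar>"
    unfolding ell1[OF e(3)] using t_le e_pos by (simp add: abs_mult)
  finally have le: "t * e / 4 * 1 \<le> \<bar>t - lamg j\<bar> * \<bar>(1 - t) * e * (real k - (real B - 1) / 2) - ell j 1\<bar>" .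
  have v: "nb u c \<notin> A" using nb_in[OF e(1,2)] by auto
  show ?thesis unfolding p'_frame_v[OF v, of k "p u"]
    by (rule margin_frame[OF e _ _ _ le]) (use t_pos t_le in \<open>auto simp: lamg_def\<close>)
qed

lemma new_star:
  assumes e: "u \<in> A" "c < d" "j < 2 * a"
  shows "t * e / 8 * x_perimeter (p' (nb' ((a + c) # u) j)) (p' ((a + c) # u)) (p' ((a + d + c) # u))
     \<le> \<bar>orient (p' (nb' ((a + c) # u) j)) (p' ((a + c) # u)) (p' ((a + d + c) # u))\<bar>"
proof -
  \<comment> \<open>Bounds the spread of \<open>- t\<close>, \<open>t\<close> and
    \<open>lamg j\<close>.\<close>
  define m where "m = (if j < a then 2 * t else 1 + t)"
  have "m / 4 \<le> \<bar>t - lamg j\<bar>" using t_pos t_le by (auto simp: m_def lamg_def)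
  hence "(m / 4) * (t * e) \<le> \<bar>t - lamg j\<bar> * \<bar>(real a + 1) * t * e - ell j (- t)\<bar>"
    using ell_star[OF e(3)] t_pos e_pos by (intro mult_mono) auto
  hence "t * e / 4 * m \<le> \<bar>t - lamg j\<bar> * \<bar>(real a + 1) * t * e - ell j (- t)\<bar>" by (simp add: mult_ac)
  moreover have "a + d + c < B" using e by (simp add: B_def)
  ultimately show ?thesis
    unfolding p'_frame_u(3)[OF e(1) \<open>a + d + c < B\<close> e(2)]
    by (intro margin_frame[OF e, of m]) (use t_pos t_le in \<open>auto simp: m_def lamg_def\<close>)
qed


section \<open>Balance of the new edges\<close>

lemma sum_split3:
  fixes f :: "nat \<Rightarrow> real"
  shows "(\<Sum>k<a + 2 * d. f k) = (\<Sum>k<a. f k) + (\<Sum>c<d. f (a + c) + f (a + d + c))"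
proof -
  have split: "(\<Sum>k<m + n. g k) = (\<Sum>k<m. g k) + (\<Sum>k<n. g (m + k))" for m n and g :: "nat \<Rightarrow> real"
    by (induction n) simp_all
  have "(\<Sum>k<a + 2 * d. f k) = (\<Sum>k<a + d + d. f k)" by (simp add: mult_2 add.assoc)
  also have "\<dots> = (\<Sum>k<a. f k) + (\<Sum>c<d. f (a + c)) + (\<Sum>c<d. f (a + d + c))"
    by (simp only: split)
  finally show ?thesis by (simp add: sum.distrib)
qed

text \<open>Clusters away from the old edge contribute \<open>B\<close> times the old balance, hence
  0. Extra points of other old edges at \<open>u\<close> cancel in pairs, and the companion of the
  edge itself offsets the imbalance of the two progressions.\<close>

lemma balanced_new:
  assumes e: "u \<in> A" "c < d" "j < 2 * a"
  shows "(\<Sum>x\<in>I'. sgn (orient (p' (nb' ((a + c) # u) j)) (p' ((a + c) # u)) (p' x))) = 0"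
proof -
  define v where "v = nb u c"
  define f where "f x = sgn (orient (p' (nb' ((a + c) # u) j)) (p' ((a + c) # u)) (p' x))" for x
  define \<xi> where "\<xi> = sgn ((Re (p v) - Re (p u)) * (t - lamg j))"
  have uI: "u \<in> I" using e A_sub by auto
  have v: "v \<in> I" "v \<notin> A" "v \<noteq> u" using nb_in[OF e(1,2)] e by (auto simp: v_def)
  have frame_sgn: "f x = \<xi> * sgn (h - ell j l)" if "p' x = frame (p u) (p v) l h" for x l h
    unfolding f_def that \<xi>_def v_def orient_new_edge[OF e] by (simp add: sgn_mult)
  have "(\<Sum>x\<in>I'. f x) = (\<Sum>(k, w)\<in>{..<B} \<times> I. f (k # w))"
    unfolding I'_def by (subst sum.reindex) (auto simp: inj_on_def split_def intro!: sum.cong)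
  also have "\<dots> = (\<Sum>w\<in>I. \<Sum>k<B. f (k # w))"
    by (subst sum.cartesian_product [symmetric], rule sum.swap)
  also have "\<dots> = (\<Sum>k<B. f (k # u)) + (\<Sum>k<B. f (k # v)) + (\<Sum>w\<in>I - {u} - {v}. \<Sum>k<B. f (k # w))"
    using fin uI v by (simp add: sum.remove[of _ u] sum.remove[of _ v])
  also have "(\<Sum>w\<in>I - {u} - {v}. \<Sum>k<B. f (k # w)) =
      (\<Sum>w\<in>I - {u} - {v}. real B * sgn (t - lamg j) * sgn (orient (p u) (p v) (p w)))"
  proof (intro sum.cong refl)
    fix w assume w: "w \<in> I - {u} - {v}"
    have "f (k # w) = sgn (t - lamg j) * sgn (orient (p u) (p v) (p w))" if "k < B" for k
      using new_far(2)[OF e, of w k] w that by (simp add: f_def v_def)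
    thus "(\<Sum>k<B. f (k # w)) = real B * sgn (t - lamg j) * sgn (orient (p u) (p v) (p w))" by simp
  qed
  also have "\<dots> = real B * sgn (t - lamg j) * (\<Sum>w\<in>I - {u} - {v}. sgn (orient (p u) (p v) (p w)))"
    by (simp add: sum_distrib_left)
  \<comment> \<open>The terms restored at \<open>u\<close> and \<open>v\<close> are zero, so the
    balance of the old edge applies.\<close>
  also have "(\<Sum>w\<in>I - {u} - {v}. sgn (orient (p u) (p v) (p w))) = (\<Sum>w\<in>I. sgn (orient (p u) (p v) (p w)))"
    using fin by (intro sum.mono_neutral_left) auto
  also have "\<dots> = 0" unfolding v_def by (rule balanced[OF e(1,2)])
  also have "(\<Sum>k<B. f (k # v)) = (\<Sum>k<B. \<xi> * sgn (real k - zv j))"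
  proof (intro sum.cong refl)
    fix k
    have "f (k # v) = \<xi> * sgn ((1 - t) * e * (real k - (real B - 1) / 2) - ell j 1)"
      by (rule frame_sgn[OF p'_frame_v[OF v(2)]])
    thus "f (k # v) = \<xi> * sgn (real k - zv j)"
      unfolding ell1[OF e(3)] using t_le e_pos by (simp add: sgn_mult)
  qed
  also have "(\<Sum>k<B. f (k # u)) = (\<Sum>k<a. f (k # u)) + (\<Sum>c'<d. f ((a + c') # u) + f ((a + d + c') # u))"
    unfolding B_def by (rule sum_split3)
  also have "(\<Sum>k<a. f (k # u)) = (\<Sum>k<a. \<xi> * sgn (real k - zu j))"
  proof (intro sum.cong refl)
    fix k assume "k \<in> {..<a}"
    hence "f (k # u) = \<xi> * sgn (t * e * (real k - (real a - 1) / 2) - ell j 0)"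
      by (intro frame_sgn p'_frame_u(1)[OF e(1)]) (auto simp: B_def)
    thus "f (k # u) = \<xi> * sgn (real k - zu j)"
      unfolding ell0[OF e(3)] using t_pos e_pos by (simp add: sgn_mult)
  qed
  \<comment> \<open>For \<open>c' = c\<close> the point y is an endpoint and counts 0, while its
    companion counts \<open>\<xi>\<close>. For other \<open>c'\<close> the two points are on
    opposite sides.\<close>
  also have "(\<Sum>c'<d. f ((a + c') # u) + f ((a + d + c') # u)) = (\<Sum>c'<d. if c' = c then \<xi> else 0)"
  proof (intro sum.cong refl)
    fix c' assume c': "c' \<in> {..<d}"
    have star: "p' ((a + d + c') # u) = frame (p u) (p (nb u c')) (- t) ((real a + 1) * t * e)"
      and near: "p' ((a + c') # u) = frame (p u) (p (nb u c')) t (hgt (a + c') u)"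
      using p'_frame_u(2,3)[OF e(1), of "a + d + c'"] c' by (auto simp: B_def)
    show "f ((a + c') # u) + f ((a + d + c') # u) = (if c' = c then \<xi> else 0)"
    proof (cases "c' = c")
      case True
      have "(real a + 1) * t * e - ell j (- t) > 0"
        using ell_star[OF e(3)] mult_pos_pos[OF t_pos e_pos] by linarith
      thus ?thesis
        using frame_sgn[of "(a + d + c') # u" "- t" "(real a + 1) * t * e"] star True
        by (simp add: v_def f_def)
    next
      case False
      have h: "\<bar>hgt (a + c') u\<bar> \<le> 2 * \<kappa>" "\<bar>(real a + 1) * t * e\<bar> \<le> 2 * \<kappa>"
        using abs_hgt_le[of "a + c'" u] abs_hgt_le[of "a + d + c'" u] c' e(1)
        by (auto simp: B_def hgt_def)
      show ?thesis
        using new_near(2)[OF e, of c' t "hgt (a + c') u"]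
          new_near(2)[OF e, of c' "- t" "(real a + 1) * t * e"] c' False t_pos t_le h
        unfolding f_def near star by simp
    qed
  qed
  also have "\<dots> = \<xi>" using e by simp
  also have "(\<Sum>k<a. \<xi> * sgn (real k - zu j)) = \<xi> * (\<Sum>k<a. sgn (real k - zu j))"
    by (simp add: sum_distrib_left)
  also have "(\<Sum>k<B. \<xi> * sgn (real k - zv j)) = \<xi> * (\<Sum>k<B. sgn (real k - zv j))"
    by (simp add: sum_distrib_left)
  \<comment> \<open>One progression contains the endpoint and the other is crossed in a gap. The
    dependence on \<open>j\<close> cancels, since a larger index at one end means a lower crossing
    at the other.\<close>
  also have "(\<Sum>k<a. sgn (real k - zu j)) + (\<Sum>k<B. sgn (real k - zv j)) = -1"
  proof (cases "j < a")
    case True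
    thus ?thesis using sum_sgn_AP(1)[of j a] sum_sgn_AP(2)[of "a + d - j" B]
      by (simp add: zu_def zv_def B_def of_nat_diff)
  next
    case False
    thus ?thesis using sum_sgn_AP(2)[of "2 * a - j" a] sum_sgn_AP(1)[of "j - a + d" B] e
      by (simp add: zu_def zv_def B_def of_nat_diff)
  qed
  hence "\<xi> * (\<Sum>k<a. sgn (real k - zu j)) + \<xi> + \<xi> * (\<Sum>k<B. sgn (real k - zv j)) +
      real B * sgn (t - lamg j) * 0 = 0"
    by algebra
  finally show ?thesis by (simp add: f_def)
qed


section \<open>The new configuration is again a scheme\<close>

lemma nb'_edge:
  assumes "u \<in> A" "c < d" "j < 2 * a"
  shows "nb' ((a + c) # u) j \<in> I' - A'"
proof (cases "j < a")
  case True
  thus ?thesis using assms A_sub by (auto simp: nb'_def I'_def A'_def B_def image_iff)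
next
  case False
  thus ?thesis using assms nb_in[OF assms(1,2)] by (auto simp: nb'_def I'_def A'_def B_def image_iff)
qed

lemma step_robust0:
  assumes e: "u \<in> A" "c < d" "j < 2 * a" and k: "k < B" "w \<in> I"
    and ne: "k # w \<noteq> (a + c) # u" "k # w \<noteq> nb' ((a + c) # u) j"
  shows "t * e / 8 * x_perimeter (p' (nb' ((a + c) # u) j)) (p' ((a + c) # u)) (p' (k # w))
     \<le> \<bar>orient (p' (nb' ((a + c) # u) j)) (p' ((a + c) # u)) (p' (k # w))\<bar>"
proof -
  have le_abs: "s * x \<le> \<bar>x\<bar>" if "\<bar>s\<bar> = 1" for s x :: real
    using that by (auto simp: abs_if split: if_splits)
  \<comment> \<open>The cases are: another cluster, the cluster of the far end, the progression of
    \<open>u\<close>, the companion of this edge, and the two extra points of each other edge at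
    \<open>u\<close>.\<close>
  consider "w \<noteq> u" "w \<noteq> nb u c" | "w = nb u c" | "w = u" "k < a" | "w = u" "k = a + d + c"
    | c' where "w = u" "k = a + c'" "c' < d" "c' \<noteq> c"
    | c' where "w = u" "k = a + d + c'" "c' < d" "c' \<noteq> c"
  proof -
    consider "k < a" | c' where "k = a + c'" "c' < d" | c' where "k = a + d + c'" "c' < d"
    proof -
      have "k < a \<or> (k - a < d \<and> k = a + (k - a)) \<or> (k - a - d < d \<and> k = a + d + (k - a - d))"
        using k by (auto simp: B_def)
      thus ?thesis using that by blast
    qed
    thus ?thesis using that ne by (metis (no_types))
  qed
  thus ?thesis
  proof cases
    case 1
    have "\<bar>sgn (t - lamg j) * sgn (orient (p u) (p (nb u c)) (p w))\<bar> = 1"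
      using sign_old[OF e(1,2) k(2) 1] t_lamg(3)[of j] by (simp add: abs_mult sgn_if)
    thus ?thesis using new_far(1)[OF e k(2) 1 k(1)] le_abs order_trans by blast
  next
    case 2
    thus ?thesis using new_AP_v[OF e, of k] ne by simp
  next
    case 3
    thus ?thesis using new_AP_u[OF e, of k] ne by simp
  next
    case 4
    thus ?thesis using new_star[OF e] by simp
  next
    case 5
    have h: "\<bar>hgt k u\<bar> \<le> 2 * \<kappa>" using abs_hgt_le[OF k(1), of u] by linarith
    have P: "p' (k # w) = frame (p u) (p (nb u c')) t (hgt k u)"
      using p'_frame_u(2)[OF e(1) k(1) 5(3)] 5 by simp
    show ?thesis unfolding P by (rule new_near(3)[OF e 5(3,4) _ _ h]) (use t_pos t_le in auto)
  next
    case 6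
    have h: "\<bar>hgt k u\<bar> \<le> 2 * \<kappa>" using abs_hgt_le[OF k(1), of u] by linarith
    have hh: "hgt k u = (real a + 1) * t * e" using 6 e by (simp add: hgt_def)
    have P: "p' (k # w) = frame (p u) (p (nb u c')) (- t) (hgt k u)"
      using p'_frame_u(3)[OF e(1) k(1) 6(3)] 6 hh by simp
    show ?thesis unfolding P by (rule new_near(3)[OF e 6(3,4) _ _ h]) (use t_pos t_le in auto)
  qed
qed

lemma frame_comb:
  "frame w z l h + of_real s * (frame w z l2 h2 - frame w z l h) =
     frame w z (l + s * (l2 - l)) (h + s * (h2 - h))"
  by (simp add: frame_def complex_eq_iff algebra_simps)

text \<open>With \<open>\<bar>s\<bar> \<le> \<tau> / 4 = t / 2\<close>, a move along a new edge
  keeps the parameter on its old edge between \<open>t / 2\<close> and \<open>3/2 * t\<close>. It is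
  thus positive and at most \<open>\<tau>\<close>, so the old margins still apply and the side does
  not change.\<close>

lemma step_robust:
  assumes e: "u \<in> A" "c < d" "j < 2 * a" and w: "w \<in> A" "c' < d" "j' < 2 * a"
    and ne: "(a + c') # w \<noteq> (a + c) # u" and s: "\<bar>s\<bar> \<le> \<tau> / 4"
  defines "q \<equiv> p' ((a + c') # w) + of_real s * (p' (nb' ((a + c') # w) j') - p' ((a + c') # w))"
  shows "t * e / 8 * x_perimeter (p' (nb' ((a + c) # u) j)) (p' ((a + c) # u)) q
     \<le> sgn (orient (p' (nb' ((a + c) # u) j)) (p' ((a + c) # u)) (p' ((a + c') # w))) *
       orient (p' (nb' ((a + c) # u) j)) (p' ((a + c) # u)) q"
proof -
  define r where "r = t + s * (lamg j' - t)"
  define h where "h = ell j' t + s * (ell j' (lamg j') - ell j' t)"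
  have q: "q = frame (p w) (p (nb w c')) r h"
    unfolding q_def p'_near[OF w(1,2), of j'] p'_nb'[OF w] frame_comb r_def h_def ..
  have st: "\<bar>s\<bar> \<le> t / 2" using s by (simp add: t_def)
  have "\<bar>s * (lamg j' - t)\<bar> \<le> (t / 2) * 1"
    unfolding abs_mult using st t_lamg(2)[of j'] t_pos by (intro mult_mono) (auto simp: abs_minus_commute)
  hence r: "t / 2 \<le> r" "r \<le> 3 / 2 * t" unfolding r_def by linarith+
  hence r': "t / 2 \<le> \<bar>r\<bar>" "\<bar>r\<bar> \<le> 1" "\<bar>r\<bar> \<le> \<tau>" "sgn r = 1"
    using t_pos t_le by (auto simp: t_def)
  have k: "\<kappa> \<ge> 0" using t_pos mu_pos by (simp add: kappa_eq)
  have "\<bar>s * (ell j' (lamg j') - ell j' t)\<bar> \<le> (1/2) * (2 * \<kappa>)"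
    unfolding abs_mult using st t_le t_pos ell_bound[OF w] by (intro mult_mono) auto
  hence h: "\<bar>h\<bar> \<le> 2 * \<kappa>" using ell_bound(1)[OF w] unfolding h_def by linarith
  have kB: "a + c' < B" using w by (simp add: B_def)
  have y: "p' ((a + c') # w) = frame (p w) (p (nb w c')) t (hgt (a + c') w)"
    by (rule p'_frame_u(2)[OF w(1) kB w(2)])
  have hy: "\<bar>hgt (a + c') w\<bar> \<le> 2 * \<kappa>" using abs_hgt_le[OF kB, of w] k by linarith
  show ?thesis
  proof (cases "w = u")
    case True
    hence c': "c' \<noteq> c" using ne by auto
    have "sgn (orient (p' (nb' ((a + c) # u) j)) (p' ((a + c) # u)) (p' ((a + c') # w)))
      = sgn (t - lamg j) * (sgn t * sgn (orient (p u) (p (nb u c)) (p (nb u c'))))"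
      unfolding y[unfolded True] True by (rule new_near(2)[OF e w(2) c' _ _ hy[unfolded True]]) (use t_pos t_le in auto)
    thus ?thesis using new_near(1)[OF e w(2) c' r'(1,2) h] r' t_pos unfolding q True by simp
  next
    case False
    have wI: "w \<in> I" "w \<noteq> nb u c" using w A_sub nb_in[OF e(1,2)] by auto
    have s1: "\<bar>sgn (t - lamg j) * sgn (orient (p u) (p (nb u c)) (p w))\<bar> = 1"
      using sign_old[OF e(1,2) wI(1) False wI(2)] t_lamg(3)[of j] by (simp add: abs_mult sgn_if)
    show ?thesis
      unfolding new_far(2)[OF e wI(1) False wI(2) kB] q
      using margin_lift[OF e s1 h refl refl margin_far[OF e(1,2) robust[OF e(1,2) w(1) False w(2) r'(3)]]]
      by (simp add: frame_def)
  qed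
qed

lemma step_bound:
  assumes "k < B" "w \<in> I"
  shows "\<bar>Re (p' (k # w))\<bar> \<le> 4 * R \<and> \<bar>Im (p' (k # w))\<bar> \<le> 4 * R"
proof -
  have comb: "\<bar>x + s * (y - x)\<bar> \<le> 3 * R" if "\<bar>x\<bar> \<le> R" "\<bar>y\<bar> \<le> R" "\<bar>s\<bar> \<le> 1" for x y s :: real
  proof -
    have "\<bar>s * (y - x)\<bar> \<le> 1 * (2 * R)"
      unfolding abs_mult using that by (intro mult_mono) auto
    thus ?thesis using that by linarith
  qed
  have t1: "\<bar>t\<bar> \<le> 1" "\<bar>- t\<bar> \<le> 1" using t_pos t_le by auto
  have nbI: "nb w c \<in> I" if "w \<in> A" "c < d" for c using nb_in[OF that] by simp
  have "k - a - d < d" if "\<not> k < a + d" using that assms by (simp add: B_def)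
  moreover have "k - a < d" if "k < a + d" "a \<le> k" using that by simp
  moreover have "\<bar>x\<bar> \<le> 3 * R" if "\<bar>x\<bar> \<le> R" for x using that by linarith
  ultimately have "\<bar>Re (base k w)\<bar> \<le> 3 * R \<and> \<bar>Im (base k w)\<bar> \<le> 3 * R"
    using bound[OF assms(2)] bound[OF nbI] comb[OF _ _ t1(1)] comb[OF _ _ t1(2)]
    by (simp add: base_def)
  moreover have "\<bar>hgt k w\<bar> \<le> R"
  proof -
    have "t\<^sup>2 * \<mu> \<le> 1 * 1" using t_pos t_le mu_pos mu_le by (intro mult_mono power_le_one) auto
    hence "\<kappa> \<le> 1" by (simp add: kappa_eq)
    thus ?thesis using abs_hgt_le[OF assms(1), of w] R_ge by linarith
  qed
  ultimately show ?thesis using R_ge by (auto simp: p'_def)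
qed

text \<open>The preceding determinants run from the neighbour to y, whereas the edges of a scheme
  start at y; this is why endpoints are swapped throughout.\<close>

lemma step_scheme: "scheme I' A' nb' p' (2 * a) (t * e / 8) (\<tau> / 4) (t * \<delta>) (4 * R)"
proof
  show "finite I'" using fin by (simp add: I'_def)
  show "A' \<subseteq> I'" using A_sub by (auto simp: A'_def I'_def B_def)
  show "2 * a > 0" using a_pos by simp
  show "t * e / 8 > 0" using t_pos e_pos by simp
  have "t\<^sup>2 * \<mu> \<le> 1 * 1" using t_pos t_le mu_pos mu_le by (intro mult_mono power_le_one) auto
  thus "t * e / 8 \<le> 1" using te_le by linarith
  show "\<tau> / 4 > 0" "\<tau> / 4 \<le> 1/2" "4 * R \<ge> 1" "t * \<delta> > 0"
    using tau_pos tau_le R_ge t_pos delta_pos by simp_all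
  show "\<bar>Re (p' w)\<bar> \<le> 4 * R \<and> \<bar>Im (p' w)\<bar> \<le> 4 * R" if "w \<in> I'" for w
    using that step_bound by (auto simp: I'_def)
next
  fix x assume "x \<in> A'"
  then obtain u c where x: "x = (a + c) # u" and e: "u \<in> A" "c < d" by (auto simp: A'_def)
  show "inj_on (nb' x) {..<2 * a}"
    using nb_in[OF e] e by (auto simp: inj_on_def nb'_def x)
  fix j assume j: "j < 2 * a"
  note e = e j
  show "nb' x j \<in> I' - A'" unfolding x by (rule nb'_edge[OF e])
  have "t * \<delta> \<le> \<bar>lamg j - t\<bar> * \<bar>Re (p (nb u c)) - Re (p u)\<bar>"
    using t_lamg(1)[of j] x_sep[OF e(1,2)] t_pos delta_pos
    by (intro mult_mono) (auto simp: abs_minus_commute)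
  also have "\<dots> = \<bar>Re (p' (nb' x j)) - Re (p' x)\<bar>"
    unfolding x p'_near[OF e(1,2), of j] p'_nb'[OF e]
    by (simp add: frame_def abs_mult [symmetric] algebra_simps)
  finally show "t * \<delta> \<le> \<bar>Re (p' (nb' x j)) - Re (p' x)\<bar>" .
  have "(\<Sum>w\<in>I'. sgn (orient (p' x) (p' (nb' x j)) (p' w))) =
      - (\<Sum>w\<in>I'. sgn (orient (p' (nb' x j)) (p' x) (p' w)))"
    by (subst orient_swap) (simp add: sgn_minus sum_negf)
  thus "(\<Sum>w\<in>I'. sgn (orient (p' x) (p' (nb' x j)) (p' w))) = 0"
    using balanced_new[OF e] by (simp add: x)
next
  fix x j y assume "x \<in> A'" and j: "j < 2 * a" and y: "y \<in> I'" "y \<noteq> x" "y \<noteq> nb' x j"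
  then obtain u c where x: "x = (a + c) # u" and e: "u \<in> A" "c < d" by (auto simp: A'_def)
  obtain k w where "y = k # w" "k < B" "w \<in> I" using y by (auto simp: I'_def)
  thus "t * e / 8 * x_perimeter (p' x) (p' (nb' x j)) (p' y) \<le> \<bar>orient (p' x) (p' (nb' x j)) (p' y)\<bar>"
    using step_robust0[OF e j, of k w] y(2,3) unfolding x
    by (subst x_perimeter_swap, subst orient_swap) simp
next
  fix x j y j' and s :: real
  assume "x \<in> A'" and j: "j < 2 * a" and "y \<in> A'" and y: "y \<noteq> x" and j': "j' < 2 * a" and s: "\<bar>s\<bar> \<le> \<tau> / 4"
  then obtain u c where x: "x = (a + c) # u" and e: "u \<in> A" "c < d" by (auto simp: A'_def)
  obtain w c' where y': "y = (a + c') # w" and w: "w \<in> A" "c' < d" using \<open>y \<in> A'\<close> by (auto simp: A'_def)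
  show "t * e / 8 * x_perimeter (p' x) (p' (nb' x j)) (p' y + of_real s * (p' (nb' y j') - p' y)) \<le>
         sgn (orient (p' x) (p' (nb' x j)) (p' y)) *
         orient (p' x) (p' (nb' x j)) (p' y + of_real s * (p' (nb' y j') - p' y))"
    unfolding x_perimeter_swap[of "p' x"] orient_swap[of "p' x"]
    using step_robust[OF e j w j' _ s] y unfolding x y' by (simp add: sgn_minus)
qed

lemma card_I': "card I' = B * card I"
  unfolding I'_def by (subst card_image) (auto simp: inj_on_def card_cartesian_product)

lemma card_A': "card A' = d * card A"
  unfolding A'_def by (subst card_image) (auto simp: inj_on_def card_cartesian_product)

end


section \<open>Iteration of the step\<close>

lemma scheme_start:
  "scheme {[0], [1]} {[0]} (\<lambda>_ _. [1]) (\<lambda>x. if x = [0] then 0 else 1) 1 1 (1/2) 1 1"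
  by unfold_locales (auto simp: inj_on_def orient_def)

text \<open>In step \<open>m\<close> every loss and every growth factor is exponential in
  \<open>m\<close>, so the accumulated bounds are exponential in \<open>m\<^sup>2\<close>.\<close>

lemma scheme_exists:
  "\<exists>I A nb p \<mu> \<delta>. scheme I A nb p (8 ^ m) \<mu> (1 / 2 / 4 ^ m) \<delta> (4 ^ m) \<and>
     \<mu> \<ge> 1 / 2 ^ (16 * m\<^sup>2) \<and> \<delta> \<ge> 1 / 2 ^ (16 * m\<^sup>2) \<and> even (card I) \<and> card I > 0 \<and>
     card I \<le> 2 * 2 ^ (16 * m\<^sup>2) \<and> real (card A * 8 ^ m) = (4/3) ^ m / 2 * real (card I)"
proof (induction m)
  case 0
  show ?case
    by (rule exI[of _ "{[0], [1]}"], rule exI[of _ "{[0]}"], rule exI[of _ "\<lambda>_ _. [1]"],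
        rule exI[of _ "\<lambda>x. if x = [0] then 0 else 1"], rule exI[of _ 1], rule exI[of _ 1])
       (use scheme_start in simp)
next
  case (Suc m)
  then obtain I A nb p \<mu> \<delta> where sch: "scheme I A nb p (8 ^ m) \<mu> (1 / 2 / 4 ^ m) \<delta> (4 ^ m)"
    and IH: "\<mu> \<ge> 1 / 2 ^ (16 * m\<^sup>2)" "\<delta> \<ge> 1 / 2 ^ (16 * m\<^sup>2)" "even (card I)" "card I > 0"
     "card I \<le> 2 * 2 ^ (16 * m\<^sup>2)" "real (card A * 8 ^ m) = (4/3) ^ m / 2 * real (card I)"
    by blast
  \<comment> \<open>With \<open>d = 8 ^ m\<close> and \<open>a = 4 * d\<close>, the points multiply
    by \<open>B = 6 * d\<close>, the set \<open>A\<close> by \<open>d\<close>, and the degree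
    becomes \<open>8 * d\<close>. Edges per point grow by 8/6.\<close>
  interpret S: scheme_step I A nb p "8 ^ m" \<mu> "1 / 2 / 4 ^ m" \<delta> "4 ^ m" "4 * 8 ^ m"
    using sch by (intro scheme_step.intro) (simp_all add: scheme_step_axioms_def)
  have B: "S.B = 6 * 8 ^ m" by (simp add: S.B_def)
  have t: "S.t = 1 / 4 ^ Suc m" unfolding S.t_def by simp
  \<comment> \<open>The increment of \<open>16 * m\<^sup>2\<close> is the budget for all losses of
    one step.\<close>
  have pw: "2 ^ (16 * (Suc m)\<^sup>2) = (2 :: real) ^ (16 * m\<^sup>2) * 2 ^ (16 + 32 * m)"
    by (simp only: power_add [symmetric]) (simp add: power2_eq_square algebra_simps)
  have "(49152 :: real) * 512 ^ m \<le> 2 ^ 16 * 2 ^ (9 * m)" by (simp add: power_mult)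
  also have "\<dots> \<le> 2 ^ 16 * 2 ^ (32 * m)" by (intro mult_left_mono power_increasing) auto
  finally have c: "(49152 :: real) * 512 ^ m \<le> 2 ^ (16 + 32 * m)" by (simp add: power_add)
  have mu: "S.t * S.e / 8 = \<mu> * (1 / (49152 * 512 ^ m))"
  proof -
    have "(512 :: real) ^ m = 4 ^ m * 4 ^ m * 4 ^ m * 8 ^ m" by (simp add: power_mult_distrib [symmetric])
    thus ?thesis unfolding S.e_def t B by (simp add: power2_eq_square)
  qed
  have "1 / 2 ^ (16 * m\<^sup>2) * (1 / 2 ^ (16 + 32 * m)) \<le> S.t * S.e / 8"
    unfolding mu using IH(1) c S.mu_pos by (intro mult_mono divide_left_mono) auto
  hence 1: "S.t * S.e / 8 \<ge> 1 / 2 ^ (16 * (Suc m)\<^sup>2)" by (simp add: pw)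
  have "(4 :: real) ^ Suc m = 2 ^ (2 + 2 * m)" by (simp add: power_mult power_add)
  also have "\<dots> \<le> 2 ^ (16 + 32 * m)" by (intro power_increasing) auto
  finally have "1 / 2 ^ (16 + 32 * m) * (1 / 2 ^ (16 * m\<^sup>2)) \<le> S.t * \<delta>"
    unfolding t using IH(2) by (intro mult_mono divide_left_mono) auto
  hence 2: "S.t * \<delta> \<ge> 1 / 2 ^ (16 * (Suc m)\<^sup>2)" by (simp add: pw mult.commute)
  have "(6 :: nat) * 8 ^ m \<le> 2 ^ 3 * 2 ^ (3 * m)" by (simp add: power_mult)
  also have "\<dots> = 2 ^ (3 + 3 * m)" by (simp add: power_add)
  also have "\<dots> \<le> 2 ^ (16 + 32 * m)" by (intro power_increasing) auto
  finally have "S.B * card I \<le> 2 ^ (16 + 32 * m) * (2 * 2 ^ (16 * m\<^sup>2))"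
    unfolding B by (intro mult_mono IH(5)) auto
  also have "\<dots> = 2 * 2 ^ (16 * (Suc m)\<^sup>2)"
    by (simp add: power_add [symmetric] power2_eq_square algebra_simps flip: power_Suc)
  finally have 3: "card S.I' \<le> 2 * 2 ^ (16 * (Suc m)\<^sup>2)" by (simp add: S.card_I')
  have 4: "real (card S.A' * 8 ^ Suc m) = (4/3) ^ Suc m / 2 * real (card S.I')"
  proof -
    have "real (card S.A' * 8 ^ Suc m) = 8 * 8 ^ m * real (card A * 8 ^ m)"
      by (simp add: S.card_A')
    also have "\<dots> = (4/3) ^ Suc m / 2 * real (card S.I')"
      unfolding IH(6) by (simp add: S.card_I' B)
    finally show ?thesis .
  qed
  have "scheme S.I' S.A' S.nb' S.p' (8 ^ Suc m) (S.t * S.e / 8) (1 / 2 / 4 ^ Suc m) (S.t * \<delta>) (4 ^ Suc m)"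
    using S.step_scheme by (simp add: field_simps)
  moreover have "even (card S.I')" "card S.I' > 0" using IH B by (simp_all add: S.card_I')
  ultimately show ?case using 1 2 3 4 by blast
qed

text \<open>
  The terms \<open>w = u\<close> and \<open>w = v\<close> of the sum vanish, so the condition says that the two sides of the
  line contain equally many points.
\<close>

definition halving_pairs :: "'a set \<Rightarrow> ('a \<Rightarrow> complex) \<Rightarrow> ('a \<times> 'a) set \<Rightarrow> bool" where
  "halving_pairs I p H \<longleftrightarrow> H \<subseteq> I \<times> I \<and> (\<forall>(u, v)\<in>H. u \<noteq> v \<and> (v, u) \<notin> H \<and>
     (\<forall>w\<in>I - {u, v}. orient (p u) (p v) (p w) \<noteq> 0) \<and>
     (\<Sum>w\<in>I. sgn (orient (p u) (p v) (p w))) = 0)"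

text \<open>An edge has abscissa difference at least \<open>\<delta>\<close>, so every perimeter is
  at least \<open>2 * \<delta>\<close> and the relative margin \<open>\<mu>\<close> becomes an
  absolute one. Edges lead from \<open>A\<close> out of \<open>A\<close>, so no pair occurs in both
  orders.\<close>

lemma robust_config_exists:
  "\<exists>(I :: nat list set) p H. finite I \<and> even (card I) \<and> card I > 0 \<and> card I \<le> 2 * 2 ^ (16 * m\<^sup>2) \<and>
     real (card H) = (4/3) ^ m / 2 * real (card I) \<and> halving_pairs I p H \<and>
     (\<forall>(u, v)\<in>H. \<forall>w\<in>I - {u, v}. 2 / 2 ^ (32 * m\<^sup>2) \<le> \<bar>orient (p u) (p v) (p w)\<bar>) \<and>
     (\<forall>w\<in>I. \<bar>Re (p w)\<bar> \<le> 4 ^ m \<and> \<bar>Im (p w)\<bar> \<le> 4 ^ m)"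
proof -
  obtain I A nb p \<mu> \<delta> where sch: "scheme I A nb p (8 ^ m) \<mu> (1 / 2 / 4 ^ m) \<delta> (4 ^ m)"
    and IH: "\<mu> \<ge> 1 / 2 ^ (16 * m\<^sup>2)" "\<delta> \<ge> 1 / 2 ^ (16 * m\<^sup>2)" "even (card I)" "card I > 0"
     "card I \<le> 2 * 2 ^ (16 * m\<^sup>2)" "real (card A * 8 ^ m) = (4/3) ^ m / 2 * real (card I)"
    using scheme_exists by blast
  interpret scheme I A nb p "8 ^ m" \<mu> "1 / 2 / 4 ^ m" \<delta> "4 ^ m" by (rule sch)
  define H where "H = (\<lambda>(u, c). (u, nb u c)) ` (A \<times> {..<8 ^ m})"
  have "card H = card (A \<times> {..<(8 :: nat) ^ m})"
    unfolding H_def using nb_inj by (intro card_image) (auto simp: inj_on_def)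
  hence cH: "real (card H) = (4/3) ^ m / 2 * real (card I)"
    using IH(6) by (simp add: card_cartesian_product)
  have rob: "2 / 2 ^ (32 * m\<^sup>2) \<le> \<bar>orient (p u) (p v) (p w)\<bar>" if uv: "(u, v) \<in> H" and w: "w \<in> I - {u, v}" for u v w
  proof -
    obtain c where c: "u \<in> A" "c < 8 ^ m" "v = nb u c" using uv by (auto simp: H_def)
    have "2 * \<bar>Re (p v) - Re (p u)\<bar> \<le> x_perimeter (p u) (p v) (p w)"
      using x_perimeter_triangle(1)[where p="p u" and q="p v" and r="p w"] by (simp add: abs_minus_commute)
    hence "1 / 2 ^ (16 * m\<^sup>2) * (2 * (1 / 2 ^ (16 * m\<^sup>2))) \<le> \<mu> * x_perimeter (p u) (p v) (p w)"
      using IH(1,2) x_sep[OF c(1,2)] mu_pos c by (intro mult_mono) auto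
    also have "\<dots> \<le> \<bar>orient (p u) (p v) (p w)\<bar>"
      using robust0[OF c(1,2), of w] w c by auto
    also have "1 / 2 ^ (16 * m\<^sup>2) * (2 * (1 / 2 ^ (16 * m\<^sup>2))) = (2 :: real) / 2 ^ (32 * m\<^sup>2)"
    proof -
      have "(2 :: real) ^ (32 * m\<^sup>2) = 2 ^ (16 * m\<^sup>2) * 2 ^ (16 * m\<^sup>2)" by (simp add: power_add [symmetric])
      thus ?thesis by simp
    qed
    finally show ?thesis .
  qed
  have "halving_pairs I p H"
    unfolding halving_pairs_def
  proof (intro conjI ballI)
    show "H \<subseteq> I \<times> I" using A_sub nb_in by (auto simp: H_def)
    fix x assume x: "x \<in> H"
    then obtain u c where c: "u \<in> A" "c < 8 ^ m" "x = (u, nb u c)" by (auto simp: H_def)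
    have "nb u c \<notin> A" using nb_in[OF c(1,2)] by auto
    hence "(nb u c, u) \<notin> H" "u \<noteq> nb u c" using c by (auto simp: H_def)
    moreover have "orient (p u) (p (nb u c)) (p w) \<noteq> 0" if "w \<in> I - {u, nb u c}" for w
    proof -
      have "(0 :: real) < 2 / 2 ^ (32 * m\<^sup>2)" by (intro divide_pos_pos zero_less_power) auto
      also have "\<dots> \<le> \<bar>orient (p u) (p (nb u c)) (p w)\<bar>"
        using x c that by (intro rob) auto
      finally show ?thesis by simp
    qed
    ultimately show "case x of (u, v) \<Rightarrow> u \<noteq> v \<and> (v, u) \<notin> H \<and>
       (\<forall>w\<in>I - {u, v}. orient (p u) (p v) (p w) \<noteq> 0) \<and> (\<Sum>w\<in>I. sgn (orient (p u) (p v) (p w))) = 0"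
      using balanced[OF c(1,2)] c by simp
  qed
  thus ?thesis using fin IH(3-5) cH rob bound by blast
qed

section \<open>From determinant signs to halving lines\<close>

text \<open>The lowest nonvanishing coefficient dominates for small positive
  \<open>s\<close>.\<close>

lemma eventually_quadratic_nonzero:
  fixes a b c :: real
  assumes "c \<noteq> 0"
  shows "\<forall>\<^sub>F s in at_right 0. a + b * s + c * s\<^sup>2 \<noteq> 0"
proof -
  consider "a \<noteq> 0" | "a = 0" "b \<noteq> 0" | "a = 0" "b = 0" by blast
  thus ?thesis
  proof cases
    case 1
    have "((\<lambda>s. a + b * s + c * s\<^sup>2) \<longlongrightarrow> a + b * 0 + c * 0\<^sup>2) (at_right 0)"
      by (intro tendsto_intros)
    thus ?thesis using 1 by (intro tendsto_imp_eventually_ne) auto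
  next
    case 2
    have "((\<lambda>s. b + c * s) \<longlongrightarrow> b + c * 0) (at_right 0)" by (intro tendsto_intros)
    hence "\<forall>\<^sub>F s in at_right 0. b + c * s \<noteq> 0" using 2 by (intro tendsto_imp_eventually_ne) auto
    moreover have "\<forall>\<^sub>F s :: real in at_right 0. s > 0" by (simp add: eventually_at_right_less)
    ultimately show ?thesis
    proof eventually_elim
      case (elim s)
      have "a + b * s + c * s\<^sup>2 = s * (b + c * s)" using 2 by (simp add: power2_eq_square algebra_simps)
      thus ?case using elim by simp
    qed
  next
    case 3
    have "\<forall>\<^sub>F s :: real in at_right 0. s > 0" by (simp add: eventually_at_right_less)
    thus ?thesis by eventually_elim (use 3 assms in simp)
  qed
qed

lemma eventually_sgn_eq:
  fixes f :: "'a \<Rightarrow> real"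
  assumes "(f \<longlongrightarrow> l) F" "l \<noteq> 0"
  shows "\<forall>\<^sub>F x in F. sgn (f x) = sgn l"
proof (cases "l > 0")
  case True
  thus ?thesis using order_tendstoD(1)[OF assms(1), of 0] by (auto elim!: eventually_mono)
next
  case False
  hence "l < 0" using assms by simp
  thus ?thesis using order_tendstoD(2)[OF assms(1), of 0] by (auto elim!: eventually_mono)
qed

text \<open>Both inequalities are strict, so that the condition survives small
  perturbations.\<close>

definition spaced :: "'a set \<Rightarrow> real \<Rightarrow> real \<Rightarrow> ('a \<Rightarrow> complex) \<Rightarrow> bool" where
  "spaced J l u p \<longleftrightarrow> (\<forall>a\<in>J. \<forall>b\<in>J. a \<noteq> b \<longrightarrow> l < dist (p a) (p b) \<and> dist (p a) (p b) < u)"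

lemma eventually_spaced:
  assumes "finite J" "spaced J l u p" "\<And>a. a \<in> J \<Longrightarrow> ((\<lambda>s. q s a) \<longlongrightarrow> p a) F"
  shows "\<forall>\<^sub>F s in F. spaced J l u (q s)"
  unfolding spaced_def
proof (intro eventually_ball_finite ballI assms(1))
  fix a b assume ab: "a \<in> J" "b \<in> J"
  show "\<forall>\<^sub>F s in F. a \<noteq> b \<longrightarrow> l < dist (q s a) (q s b) \<and> dist (q s a) (q s b) < u"
  proof (cases "a = b")
    case False
    have "((\<lambda>s. dist (q s a) (q s b)) \<longlongrightarrow> dist (p a) (p b)) F"
      by (intro tendsto_dist assms ab)
    moreover have "l < dist (p a) (p b)" "dist (p a) (p b) < u"
      using assms(2) ab False by (auto simp: spaced_def)
    ultimately show ?thesis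
      by (auto dest: order_tendstoD intro: eventually_conj)
  qed simp
qed

text \<open>The eventual signs are prescribed by \<open>\<sigma>\<close> and not read off at the
  limit: points on a common ray become collinear there, and their signs appear only before the
  limit.\<close>

lemma eventually_halving_pairs:
  assumes "finite J" "H \<subseteq> J \<times> J"
   and asym: "\<And>u v. (u, v) \<in> H \<Longrightarrow> u \<noteq> v \<and> (v, u) \<notin> H"
   and ev: "\<And>u v w. (u, v) \<in> H \<Longrightarrow> w \<in> J \<Longrightarrow> w \<noteq> u \<Longrightarrow> w \<noteq> v \<Longrightarrow>
      \<sigma> u v w \<noteq> 0 \<and> (\<forall>\<^sub>F s in F. sgn (orient (q s u) (q s v) (q s w)) = \<sigma> u v w)"
   and zero: "\<And>u v. (u, v) \<in> H \<Longrightarrow> \<sigma> u v u = 0 \<and> \<sigma> u v v = 0 \<and> (\<Sum>w\<in>J. \<sigma> u v w) = 0"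
  shows "\<forall>\<^sub>F s in F. halving_pairs J (q s) H"
proof -
  have finH: "finite H" using assms(1,2) finite_subset by blast
  have "\<forall>\<^sub>F s in F. \<forall>x\<in>H. \<forall>w\<in>J - {fst x, snd x}.
      sgn (orient (q s (fst x)) (q s (snd x)) (q s w)) = \<sigma> (fst x) (snd x) w"
    using ev assms(1) by (intro eventually_ball_finite finH ballI) auto
  thus ?thesis
  proof eventually_elim
    case (elim s)
    show ?case unfolding halving_pairs_def
    proof (intro conjI ballI assms(2))
      fix x assume x: "x \<in> H"
      obtain u v where uv: "x = (u, v)" by force
      have sg: "sgn (orient (q s u) (q s v) (q s w)) = \<sigma> u v w" if "w \<in> J" "w \<noteq> u" "w \<noteq> v" for w
        using elim x that uv by force
      have "(\<Sum>w\<in>J. sgn (orient (q s u) (q s v) (q s w))) = (\<Sum>w\<in>J. \<sigma> u v w)"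
        using sg zero[of u v] x uv by (intro sum.cong refl) (metis orient_same(1,2) sgn_0)
      hence "(\<Sum>w\<in>J. sgn (orient (q s u) (q s v) (q s w))) = 0" using zero[of u v] x uv by simp
      moreover have "orient (q s u) (q s v) (q s w) \<noteq> 0" if "w \<in> J - {u, v}" for w
        using sg[of w] ev[of u v w] that x uv by auto
      ultimately show "case x of (u, v) \<Rightarrow> u \<noteq> v \<and> (v, u) \<notin> H \<and>
         (\<forall>w\<in>J - {u, v}. orient (q s u) (q s v) (q s w) \<noteq> 0) \<and>
         (\<Sum>w\<in>J. sgn (orient (q s u) (q s v) (q s w))) = 0"
        using asym[of u v] x uv by simp
    qed
  qed
qed

section \<open>Passage from complex numbers to the plane\<close>

definition vec2 :: "complex \<Rightarrow> plane" where "vec2 z = vector [Re z, Im z]"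

lemma vec2_nth [simp]: "vec2 z $ 1 = Re z" "vec2 z $ 2 = Im z"
  by (simp_all add: vec2_def)

lemma inj_vec2: "vec2 z = vec2 w \<longleftrightarrow> z = w"
  by (simp add: vec_eq_iff forall_2 complex_eq_iff)

lemma dist_vec2: "dist (vec2 z) (vec2 w) = dist z w"
  by (simp add: dist_norm norm_vec_def L2_set_def sum_2 cmod_def)

lemma collinear_vec2:
  assumes "collinear {vec2 p, vec2 q, vec2 r}"
  shows "orient p q r = 0"
proof -
  have "collinear {0, vec2 p - vec2 q, vec2 r - vec2 q}"
    using assms collinear_3[of "vec2 p" "vec2 q" "vec2 r"] by simp
  hence "vec2 p = vec2 q \<or> vec2 r = vec2 q \<or> (\<exists>c. vec2 r - vec2 q = c *\<^sub>R (vec2 p - vec2 q))"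
    by (simp add: collinear_lemma)
  thus ?thesis
  proof (elim disjE exE)
    fix c assume "vec2 r - vec2 q = c *\<^sub>R (vec2 p - vec2 q)"
    hence "Re r - Re q = c * (Re p - Re q)" "Im r - Im q = c * (Im p - Im q)"
      by (simp_all add: vec_eq_iff forall_2)
    hence "Re r = Re q + c * (Re p - Re q)" "Im r = Im q + c * (Im p - Im q)" by simp_all
    thus ?thesis unfolding orient_def by algebra
  qed (simp_all add: inj_vec2)
qed

text \<open>The vector \<open>q - p\<close> turned by a quarter turn, so that the two sides of the
  line match the signs of \<open>orient\<close>.\<close>

definition nrm :: "complex \<Rightarrow> complex \<Rightarrow> plane" where
  "nrm p q = vector [Im p - Im q, Re q - Re p]"

lemma nrm_inner: "nrm p q \<bullet> x - nrm p q \<bullet> vec2 p = orient p q (Complex (x $ 1) (x $ 2))"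
  by (simp add: nrm_def inner_vec_def sum_2 orient_def algebra_simps)

lemma nrm_inner_vec2: "nrm p q \<bullet> vec2 r - nrm p q \<bullet> vec2 p = orient p q r"
  by (simp add: nrm_inner)

lemma line_vec2:
  assumes "p \<noteq> q"
  shows "affine hull {vec2 p, vec2 q} = {x. nrm p q \<bullet> x = nrm p q \<bullet> vec2 p}"
proof (intro set_eqI iffI)
  fix x assume "x \<in> affine hull {vec2 p, vec2 q}"
  then obtain a b where "x = a *\<^sub>R vec2 p + b *\<^sub>R vec2 q" "a + b = 1"
    by (auto simp: affine_hull_2)
  moreover have "nrm p q \<bullet> vec2 q = nrm p q \<bullet> vec2 p"
    using nrm_inner_vec2[of p q q] by simp
  ultimately show "x \<in> {x. nrm p q \<bullet> x = nrm p q \<bullet> vec2 p}"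
    by (simp add: inner_add_right distrib_right [symmetric])
next
  fix x assume "x \<in> {x. nrm p q \<bullet> x = nrm p q \<bullet> vec2 p}"
  hence o: "orient p q (Complex (x $ 1) (x $ 2)) = 0" using nrm_inner[of p q x] by simp
  define X Y where "X = Re q - Re p" and "Y = Im q - Im p"
  define D where "D = X\<^sup>2 + Y\<^sup>2"
  have "D \<noteq> 0" using assms by (auto simp: D_def X_def Y_def complex_eq_iff sum_power2_eq_zero_iff)
  \<comment> \<open>The coefficient of the orthogonal projection of \<open>x\<close> onto the
    line.\<close>
  define b where "b = ((x $ 1 - Re p) * X + (x $ 2 - Im p) * Y) / D"
  have cr: "X * (x $ 2 - Im p) = (x $ 1 - Re p) * Y" using o by (simp add: orient_def X_def Y_def)
  have "b * X = x $ 1 - Re p"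
  proof -
    have "((x $ 1 - Re p) * X + (x $ 2 - Im p) * Y) * X = (x $ 1 - Re p) * D"
      unfolding D_def using cr by algebra
    thus ?thesis using \<open>D \<noteq> 0\<close> by (simp add: b_def field_simps)
  qed
  moreover have "b * Y = x $ 2 - Im p"
  proof -
    have "((x $ 1 - Re p) * X + (x $ 2 - Im p) * Y) * Y = (x $ 2 - Im p) * D"
      unfolding D_def using cr by algebra
    thus ?thesis using \<open>D \<noteq> 0\<close> by (simp add: b_def field_simps)
  qed
  ultimately have "x = (1 - b) *\<^sub>R vec2 p + b *\<^sub>R vec2 q"
    by (simp add: vec_eq_iff forall_2 X_def Y_def algebra_simps)
  thus "x \<in> affine hull {vec2 p, vec2 q}"
    unfolding affine_hull_2 by (intro CollectI exI[of _ "1 - b"] exI[of _ b]) simp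
qed


lemma dense_spaced:
  assumes "finite J" "card J \<ge> 2" "\<alpha> > 0" "spaced J \<alpha> (4 * \<alpha> * sqrt (real (card J))) q"
  shows "finite ((\<lambda>j. vec2 (q j)) ` J)" "card ((\<lambda>j. vec2 (q j)) ` J) = card J"
    "inj_on (\<lambda>j. vec2 (q j)) J" "dense_point_set 4 ((\<lambda>j. vec2 (q j)) ` J)"
proof -
  let ?P = "(\<lambda>j. vec2 (q j)) ` J"
  have sp: "\<alpha> < dist (q a) (q b) \<and> dist (q a) (q b) < 4 * \<alpha> * sqrt (real (card J))"
    if "a \<in> J" "b \<in> J" "a \<noteq> b" for a b
    using assms(4) that by (auto simp: spaced_def)
  show inj: "inj_on (\<lambda>j. vec2 (q j)) J"
  proof (rule inj_onI, rule ccontr)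
    fix a b assume "a \<in> J" "b \<in> J" "vec2 (q a) = vec2 (q b)" "a \<noteq> b"
    thus False using sp[of a b] assms(3) by (simp add: inj_vec2)
  qed
  show fin: "finite ?P" using assms(1) by simp
  show card: "card ?P = card J" by (rule card_image[OF inj])
  have "pair_distances ?P \<subseteq> (\<lambda>(x, y). dist x y) ` (?P \<times> ?P)" by (auto simp: pair_distances_def)
  hence finD: "finite (pair_distances ?P)" using fin finite_subset by blast
  have D: "\<alpha> < x \<and> x < 4 * \<alpha> * sqrt (real (card J))" if x: "x \<in> pair_distances ?P" for x
  proof -
    obtain a b where ab: "x = dist (vec2 (q a)) (vec2 (q b))" "a \<in> J" "b \<in> J" "vec2 (q a) \<noteq> vec2 (q b)"
      using x unfolding pair_distances_def by blast
    hence "a \<noteq> b" by blast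
    thus ?thesis using sp[OF ab(2,3)] unfolding ab(1) dist_vec2 by simp
  qed
  have "\<not> card ?P \<le> Suc 0" using card assms(2) by simp
  hence "\<exists>x\<in>?P. \<exists>y\<in>?P. x \<noteq> y" using card_le_Suc0_iff_eq[OF fin] by blast
  hence ne: "pair_distances ?P \<noteq> {}" unfolding pair_distances_def by blast
  have "Max (pair_distances ?P) / Min (pair_distances ?P) \<le> (4 * \<alpha> * sqrt (real (card J))) / \<alpha>"
    using D[OF Max_in[OF finD ne]] D[OF Min_in[OF finD ne]] assms(3) by (intro frac_le) auto
  thus "dense_point_set 4 ?P" using assms(3) fin card by (simp add: dense_point_set_def)
qed

text \<open>Off the pair no sign is zero, so a vanishing sum of signs splits the remaining points
  evenly. The second claim lets a line be traced back to its pair.\<close>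

lemma halving_line_pair:
  assumes "finite J" and inj: "inj_on (\<lambda>j. vec2 (q j)) J" and H: "halving_pairs J q H" "(a, b) \<in> H"
  shows "halving_line ((\<lambda>j. vec2 (q j)) ` J) (affine hull {vec2 (q a), vec2 (q b)})"
    "affine hull {vec2 (q a), vec2 (q b)} \<inter> (\<lambda>j. vec2 (q j)) ` J = {vec2 (q a), vec2 (q b)}"
proof -
  let ?P = "(\<lambda>j. vec2 (q j)) ` J" and ?o = "\<lambda>c. orient (q a) (q b) (q c)"
  have ab: "a \<in> J" "b \<in> J" "a \<noteq> b" and off: "\<And>c. c \<in> J - {a, b} \<Longrightarrow> ?o c \<noteq> 0"
    and bal: "(\<Sum>c\<in>J. sgn (?o c)) = 0"
    using H unfolding halving_pairs_def by fast+
  have neq: "vec2 (q a) \<noteq> vec2 (q b)" "q a \<noteq> q b" using inj_onD[OF inj, of a b] ab by (auto simp: inj_vec2)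
  note line = line_vec2[OF neq(2)]
  show "affine hull {vec2 (q a), vec2 (q b)} \<inter> ?P = {vec2 (q a), vec2 (q b)}"
  proof -
    have "vec2 (q c) \<in> affine hull {vec2 (q a), vec2 (q b)} \<longleftrightarrow> ?o c = 0" for c
      unfolding line using nrm_inner_vec2[of "q a" "q b" "q c"] by auto
    thus ?thesis using ab off by (auto simp: orient_same)
  qed
  let ?N = "{c \<in> J. ?o c < 0}" and ?Q = "{c \<in> J. ?o c > 0}"
  have side: "nrm (q a) (q b) \<bullet> vec2 (q c) < nrm (q a) (q b) \<bullet> vec2 (q a) \<longleftrightarrow> ?o c < 0"
    "nrm (q a) (q b) \<bullet> vec2 (q a) < nrm (q a) (q b) \<bullet> vec2 (q c) \<longleftrightarrow> ?o c > 0" for c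
    using nrm_inner_vec2[of "q a" "q b" "q c"] by linarith+
  have lt: "{x \<in> ?P. nrm (q a) (q b) \<bullet> x < nrm (q a) (q b) \<bullet> vec2 (q a)} = (\<lambda>j. vec2 (q j)) ` ?N"
    and gt: "{x \<in> ?P. nrm (q a) (q b) \<bullet> x > nrm (q a) (q b) \<bullet> vec2 (q a)} = (\<lambda>j. vec2 (q j)) ` ?Q"
    by (auto simp: side)
  have cards: "card ((\<lambda>j. vec2 (q j)) ` ?N) = card ?N" "card ((\<lambda>j. vec2 (q j)) ` ?Q) = card ?Q"
    "card ?P = card J"
    by (intro card_image inj_on_subset[OF inj]; auto)+
  have "J - {a, b} = ?N \<union> ?Q"
    using off by (auto simp: linorder_neq_iff)
  moreover have "card (?N \<union> ?Q) = card ?N + card ?Q"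
    using assms(1) by (intro card_Un_disjoint) auto
  moreover have "card (J - {a, b}) + 2 = card J"
    using ab assms(1) card_mono[OF assms(1), of "{a, b}"] by (simp add: card_Diff_subset)
  ultimately have tot: "card J = card ?N + card ?Q + 2" by simp
  have "(\<Sum>c\<in>J. sgn (?o c)) = (\<Sum>c\<in>J. (if ?o c > 0 then 1 else 0) - (if ?o c < 0 then 1 else 0))"
    by (intro sum.cong) (auto simp: sgn_if)
  also have "\<dots> = real (card ?Q) - real (card ?N)"
    using assms(1) by (simp add: sum_subtractf sum.If_cases Int_def)
  finally have eq: "real (card ?Q) = real (card ?N)" using bal by simp
  have nz: "nrm (q a) (q b) \<noteq> 0"
    using neq(2) by (auto simp: nrm_def vec_eq_iff forall_2 complex_eq_iff)
  have A: "real (card {x \<in> ?P. nrm (q a) (q b) \<bullet> x < nrm (q a) (q b) \<bullet> vec2 (q a)}) = (real (card ?P) - 2) / 2"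
    "real (card {x \<in> ?P. nrm (q a) (q b) \<bullet> x > nrm (q a) (q b) \<bullet> vec2 (q a)}) = (real (card ?P) - 2) / 2"
    unfolding lt gt cards using tot eq by simp_all
  show "halving_line ?P (affine hull {vec2 (q a), vec2 (q b)})"
    unfolding halving_line_def
  proof (rule conjI)
    show "\<exists>p\<in>?P. \<exists>r\<in>?P. p \<noteq> r \<and> affine hull {vec2 (q a), vec2 (q b)} = affine hull {p, r}"
      using ab neq(1) by (intro bexI[of _ "vec2 (q a)"] bexI[of _ "vec2 (q b)"] conjI refl imageI)
    show "\<exists>n c. n \<noteq> 0 \<and> affine hull {vec2 (q a), vec2 (q b)} = {x. n \<bullet> x = c} \<and>
       real (card {x \<in> ?P. n \<bullet> x < c}) = (real (card ?P) - 2) / 2 \<and>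
       real (card {x \<in> ?P. n \<bullet> x > c}) = (real (card ?P) - 2) / 2"
      by (intro exI[of _ "nrm (q a) (q b)"] exI[of _ "nrm (q a) (q b) \<bullet> vec2 (q a)"] conjI nz line A)
  qed
qed

text \<open>Spacing and halving are open conditions, so a small perturbation to general position
  keeps both.\<close>

lemma halving_lines_of_pairs:
  assumes fin: "finite J" and card: "card J \<ge> 2" and \<alpha>: "\<alpha> > 0" and H: "halving_pairs J p H"
    and sp: "spaced J \<alpha> (4 * \<alpha> * sqrt (real (card J))) p"
  shows "\<exists>P :: plane set. finite P \<and> card P = card J \<and> general_position P \<and> dense_point_set 4 P \<and>
    card H \<le> card {L. halving_line P L}"
proof -
  have "\<exists>f :: 'a \<Rightarrow> nat. inj_on f J" using finite_imp_inj_to_nat_seg[OF fin] by metis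
  then obtain f :: "'a \<Rightarrow> nat" where f: "inj_on f J" ..
  \<comment> \<open>Moving the points along a parabola adds a Vandermonde determinant as the quadratic coefficient.\<close>
  define q where "q s j = p j + of_real s * Complex (real (f j)) ((real (f j))\<^sup>2)" for s :: real and j
  have lim: "((\<lambda>s. q s j) \<longlongrightarrow> p j) (at_right 0)" for j
  proof -
    have "((\<lambda>s. q s j) \<longlongrightarrow> p j + of_real 0 * Complex (real (f j)) ((real (f j))\<^sup>2)) (at_right 0)"
      unfolding q_def by (intro tendsto_intros)
    thus ?thesis by simp
  qed
  have limo: "((\<lambda>s. orient (q s a) (q s b) (q s c)) \<longlongrightarrow> orient (p a) (p b) (p c)) (at_right 0)" for a b c
    unfolding orient_def by (intro tendsto_intros lim)
  have HJ: "H \<subseteq> J \<times> J" using H by (auto simp: halving_pairs_def)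
  have e1: "\<forall>\<^sub>F s in at_right 0. spaced J \<alpha> (4 * \<alpha> * sqrt (real (card J))) (q s)"
    by (intro eventually_spaced[OF fin sp] lim)
  have e2: "\<forall>\<^sub>F s in at_right 0. halving_pairs J (q s) H"
  proof (rule eventually_halving_pairs[OF fin HJ])
    fix u v assume uv: "(u, v) \<in> H"
    have h: "u \<noteq> v" "(v, u) \<notin> H" "\<And>w. w \<in> J - {u, v} \<Longrightarrow> orient (p u) (p v) (p w) \<noteq> 0"
     "(\<Sum>w\<in>J. sgn (orient (p u) (p v) (p w))) = 0"
      using H uv unfolding halving_pairs_def by fast+
    show "u \<noteq> v \<and> (v, u) \<notin> H" using h by simp
    show "sgn (orient (p u) (p v) (p u)) = 0 \<and> sgn (orient (p u) (p v) (p v)) = 0 \<and>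
        (\<Sum>w\<in>J. sgn (orient (p u) (p v) (p w))) = 0" using h by simp
    fix w assume "w \<in> J" "w \<noteq> u" "w \<noteq> v"
    thus "sgn (orient (p u) (p v) (p w)) \<noteq> 0 \<and> (\<forall>\<^sub>F s in at_right 0.
        sgn (orient (q s u) (q s v) (q s w)) = sgn (orient (p u) (p v) (p w)))"
      using h(3)[of w] by (intro conjI eventually_sgn_eq[OF limo]) (auto simp: sgn_zero_iff)
  qed
  have e3: "\<forall>\<^sub>F s in at_right 0. \<forall>a\<in>J. \<forall>b\<in>J. \<forall>c\<in>J. a \<noteq> b \<and> a \<noteq> c \<and> b \<noteq> c \<longrightarrow>
      orient (q s a) (q s b) (q s c) \<noteq> 0"
  proof (intro eventually_ball_finite fin ballI)
    fix a b c assume abc: "a \<in> J" "b \<in> J" "c \<in> J"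
    show "\<forall>\<^sub>F s in at_right 0. a \<noteq> b \<and> a \<noteq> c \<and> b \<noteq> c \<longrightarrow> orient (q s a) (q s b) (q s c) \<noteq> 0"
    proof (cases "a \<noteq> b \<and> a \<noteq> c \<and> b \<noteq> c")
      case True
      define x y z where "x = real (f a)" and "y = real (f b)" and "z = real (f c)"
      have xyz: "x \<noteq> y" "x \<noteq> z" "y \<noteq> z"
        using True abc f by (auto simp: x_def y_def z_def inj_on_def)
      define A where "A = orient (p a) (p b) (p c)"
      define B where "B = (y - x) * (Im (p c) - Im (p a)) + (Re (p b) - Re (p a)) * (z\<^sup>2 - x\<^sup>2)
         - (z - x) * (Im (p b) - Im (p a)) - (Re (p c) - Re (p a)) * (y\<^sup>2 - x\<^sup>2)"
      have "orient (q s a) (q s b) (q s c) = A + B * s + ((y - x) * (z - x) * (z - y)) * s\<^sup>2" for s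
        unfolding A_def B_def orient_def q_def x_def [symmetric] y_def [symmetric] z_def [symmetric]
        by (simp add: algebra_simps power2_eq_square)
      thus ?thesis
        using eventually_quadratic_nonzero[of "(y - x) * (z - x) * (z - y)" A B] xyz
        by (auto elim!: eventually_mono)
    next
      case False
      thus ?thesis by (intro always_eventually) blast
    qed
  qed
  have nb: "at_right (0 :: real) \<noteq> bot" by simp
  from eventually_happens'[OF nb eventually_conj[OF e1 eventually_conj[OF e2 e3]]]
  obtain s where s0: "spaced J \<alpha> (4 * \<alpha> * sqrt (real (card J))) (q s) \<and> halving_pairs J (q s) H \<and>
     (\<forall>a\<in>J. \<forall>b\<in>J. \<forall>c\<in>J. a \<noteq> b \<and> a \<noteq> c \<and> b \<noteq> c \<longrightarrow> orient (q s a) (q s b) (q s c) \<noteq> 0)" ..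
  have s: "spaced J \<alpha> (4 * \<alpha> * sqrt (real (card J))) (q s)" "halving_pairs J (q s) H"
    using s0 by simp_all
  have gen: "orient (q s a) (q s b) (q s c) \<noteq> 0"
    if "a \<in> J" "b \<in> J" "c \<in> J" "a \<noteq> b" "a \<noteq> c" "b \<noteq> c" for a b c
    using s0 that by simp
  note D = dense_spaced[OF fin card \<alpha> s(1)]
  let ?P = "(\<lambda>j. vec2 (q s j)) ` J"
  have "general_position ?P"
    unfolding general_position_def
  proof (intro ballI impI notI)
    fix x y z assume "x \<in> ?P" "y \<in> ?P" "z \<in> ?P" and ne: "x \<noteq> y \<and> x \<noteq> z \<and> y \<noteq> z"
      and col: "collinear {x, y, z}"
    then obtain a b c where abc: "a \<in> J" "b \<in> J" "c \<in> J"
      "x = vec2 (q s a)" "y = vec2 (q s b)" "z = vec2 (q s c)" by blast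
    hence "a \<noteq> b" "a \<noteq> c" "b \<noteq> c" using ne by auto
    thus False using gen[OF abc(1-3)] collinear_vec2 col abc(4-6) by simp
  qed
  moreover have "card H \<le> card {L. halving_line ?P L}"
  proof -
    let ?g = "\<lambda>(a, b). affine hull {vec2 (q s a), vec2 (q s b)}"
    have "inj_on ?g H"
    proof (rule inj_onI)
      fix x y assume x: "x \<in> H" and y: "y \<in> H" and eq: "?g x = ?g y"
      obtain a b c d where ab: "x = (a, b)" "y = (c, d)" by (metis surj_pair)
      have J: "a \<in> J" "b \<in> J" "c \<in> J" "d \<in> J" using x y ab HJ by auto
      have asym: "(b, a) \<notin> H" using x ab H unfolding halving_pairs_def by fast
      have L: "affine hull {vec2 (q s a), vec2 (q s b)} = affine hull {vec2 (q s c), vec2 (q s d)}"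
        using eq by (simp only: ab case_prod_conv)
      \<comment> \<open>Each line meets the set in exactly its two defining points; the antisymmetry
        of \<open>H\<close> then excludes the reversed pair.\<close>
      have "{vec2 (q s a), vec2 (q s b)} = {vec2 (q s c), vec2 (q s d)}"
        using halving_line_pair(2)[OF fin D(3) s(2) x[unfolded ab]]
          halving_line_pair(2)[OF fin D(3) s(2) y[unfolded ab]] unfolding L by (rule trans[OF sym])
      hence "vec2 (q s a) = vec2 (q s c) \<and> vec2 (q s b) = vec2 (q s d) \<or>
          vec2 (q s a) = vec2 (q s d) \<and> vec2 (q s b) = vec2 (q s c)"
        by (simp only: doubleton_eq_iff)
      hence "a = c \<and> b = d \<or> a = d \<and> b = c"
        using inj_onD[OF D(3), of a c] inj_onD[OF D(3), of b d] inj_onD[OF D(3), of a d] inj_onD[OF D(3), of b c] J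
        by blast
      thus "x = y" using asym y ab by auto
    qed
    hence "card H = card (?g ` H)" by (simp add: card_image)
    also have "\<dots> \<le> card {L. halving_line ?P L}"
    proof (rule card_mono)
      have "{L. halving_line ?P L} \<subseteq> (\<lambda>(x, y). affine hull {x, y}) ` (?P \<times> ?P)"
        by (auto simp: halving_line_def)
      thus "finite {L. halving_line ?P L}" using D(1) finite_subset by blast
      show "?g ` H \<subseteq> {L. halving_line ?P L}"
        using halving_line_pair(1)[OF fin D(3) s(2)] by auto
    qed
    finally show ?thesis .
  qed
  ultimately show ?thesis using D by blast
qed

section \<open>Copies on an odd number of rays\<close>

lemma sgn_sin_ray_sum:
  assumes "k < Z"
  shows "(\<Sum>k'<Z. sgn (sin (2 * pi * (real k' - real k) / real Z))) = 0"
proof -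
  \<comment> \<open>The reflection of the rays in ray \<open>k\<close>, that is
    \<open>2 * k - k'\<close> reduced modulo \<open>Z\<close>. It reverses the sign of the
    sine.\<close>
  define g where "g k' = (if 2 * k < k' then 2 * k + Z - k' else if k' + Z \<le> 2 * k then 2 * k - k' - Z
     else 2 * k - k')" for k'
  define f where "f k' = sin (2 * pi * (real k' - real k) / real Z)" for k' :: nat
  have f: "f (g k') = - f k'" if "k' < Z" for k'
  proof -
    have Z: "real Z > 0" using assms by simp
    consider "2 * k < k'" | "\<not> 2 * k < k'" "k' + Z \<le> 2 * k" | "\<not> 2 * k < k'" "\<not> k' + Z \<le> 2 * k" by blast
    thus ?thesis
    proof cases
      case 1
      have "2 * pi * (real (g k') - real k) / real Z = - (2 * pi * (real k' - real k) / real Z) + 2 * pi"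
        using 1 that Z by (simp add: g_def of_nat_diff field_simps)
      thus ?thesis unfolding f_def by (simp only: sin_periodic sin_minus)
    next
      case 2
      have "2 * pi * (real (g k') - real k) / real Z = - (2 * pi * (real k' - real k) / real Z + 2 * pi)"
        using 2 that Z by (simp add: g_def of_nat_diff field_simps)
      thus ?thesis unfolding f_def by (simp only: sin_periodic sin_minus)
    next
      case 3
      have "2 * pi * (real (g k') - real k) / real Z = - (2 * pi * (real k' - real k) / real Z)"
        using 3 that Z by (simp add: g_def of_nat_diff field_simps)
      thus ?thesis unfolding f_def by (simp only: sin_minus)
    qed
  qed
  have "(\<Sum>k'<Z. sgn (f k')) = (\<Sum>k'<Z. - sgn (f k'))"
    using assms by (intro sum.reindex_bij_witness[of _ g g]) (auto simp: f sgn_minus, auto simp: g_def)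
  thus ?thesis by (simp add: sum_negf f_def)
qed

lemma sin_rational_nonzero:
  fixes a b :: int
  assumes "b > 0" "\<not> b dvd a"
  shows "sin (pi * real_of_int a / real_of_int b) \<noteq> 0"
proof
  assume "sin (pi * real_of_int a / real_of_int b) = 0"
  then obtain i :: int where "pi * real_of_int a / real_of_int b = real_of_int i * pi"
    by (auto simp: sin_zero_iff_int2)
  hence "real_of_int a = real_of_int (i * b)" using assms(1) by (simp add: field_simps)
  hence "a = i * b" by linarith
  thus False using assms(2) by simp
qed

lemma sin_ge_half:
  fixes y :: real
  assumes "0 \<le> y" "y \<le> pi / 3"
  shows "y / 2 \<le> sin y"
proof -
  have "sin 0 - 0 / 2 \<le> sin y - y / 2"
  proof (rule DERIV_nonneg_imp_nondecreasing[OF assms(1), of "\<lambda>y. sin y - y / 2"])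
    fix x assume x: "0 \<le> x" "x \<le> y"
    have "cos (pi / 3) \<le> cos x" using x assms by (intro cos_monotone_0_pi_le) auto
    hence "cos x - 1/2 \<ge> 0" by (simp add: cos_60)
    moreover have "((\<lambda>y. sin y - y / 2) has_real_derivative cos x - 1/2) (at x)"
      by (auto intro!: derivative_eq_intros)
    ultimately show "\<exists>d. ((\<lambda>y. sin y - y / 2) has_real_derivative d) (at x) \<and> 0 \<le> d" by blast
  qed
  thus ?thesis by simp
qed

text \<open>The sine is half the distance of two vertices of a regular \<open>S\<close>-gon in the
  unit circle. Reflecting \<open>l\<close> to \<open>S - l\<close> leaves the increasing range,
  where \<open>l = 1\<close> is the worst case and \<open>pi > 3\<close> gives the bound.\<close>

lemma sin_polygon:
  assumes "1 \<le> l" "l < S"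
  shows "3 / (2 * real S) \<le> sin (pi * real l / real S)"
proof -
  have main: "3 / (2 * real S) \<le> sin (pi * real l / real S)" if l: "1 \<le> l" "2 * l \<le> S" "S > 2" for l
  proof -
    have "pi / real S / 2 \<le> sin (pi / real S)"
    proof (rule sin_ge_half)
      show "pi / real S \<le> pi / 3" using l by (intro divide_left_mono) auto
    qed simp
    also have "\<dots> \<le> sin (pi * real l / real S)"
    proof (rule sin_monotone_2pi_le)
      have "0 \<le> pi / real S" by simp
      thus "- (pi / 2) \<le> pi / real S" using pi_gt_zero by linarith
      show "pi / real S \<le> pi * real l / real S" using l by (intro divide_right_mono) auto
      have "pi * (2 * real l) \<le> pi * real S" using l by (intro mult_left_mono) auto
      thus "pi * real l / real S \<le> pi / 2" using l by (simp add: field_simps)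
    qed
    finally have "pi / real S / 2 \<le> sin (pi * real l / real S)" .
    moreover have "3 / (2 * real S) \<le> pi / real S / 2"
      using l pi_gt3 by (simp add: field_simps)
    ultimately show ?thesis by linarith
  qed
  consider "S = 2" | "S > 2" "2 * l \<le> S" | "S > 2" "2 * (S - l) \<le> S" using assms by linarith
  thus ?thesis
  proof cases
    case 1
    hence "l = 1" using assms by simp
    thus ?thesis using 1 by simp
  next
    case 2
    thus ?thesis using main assms by simp
  next
    case 3
    have "pi * real (S - l) / real S = pi - pi * real l / real S"
      using assms by (simp add: of_nat_diff field_simps)
    moreover have "3 / (2 * real S) \<le> sin (pi * real (S - l) / real S)" using main[of "S - l"] 3 assms by simp
    ultimately show ?thesis by simp
  qed
qed

lemma orient_rotate: "orient (cis a * x) (cis a * y) (cis a * z) = orient x y z"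
proof -
  have "orient (w * x) (w * y) (w * z) = ((Re w)\<^sup>2 + (Im w)\<^sup>2) * orient x y z" for w
    by (simp add: orient_def algebra_simps power2_eq_square)
  from this[of "cis a"] show ?thesis by simp
qed

lemma dist_cis: "dist (cis a) (cis b) = 2 * \<bar>sin ((a - b) / 2)\<bar>"
proof -
  have "(dist (cis a) (cis b))\<^sup>2 = (cos a - cos b)\<^sup>2 + (sin a - sin b)\<^sup>2"
    by (simp add: dist_norm cmod_power2)
  also have "\<dots> = 2 - 2 * cos (a - b)"
    using sin_cos_squared_add[of a] sin_cos_squared_add[of b]
    by (simp add: cos_diff power2_eq_square algebra_simps)
  also have "\<dots> = (2 * \<bar>sin ((a - b) / 2)\<bar>)\<^sup>2"
  proof -
    have "2 * ((a - b) / 2) = a - b" by (simp only: nonzero_mult_div_cancel_left times_divide_eq_right)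
    hence "cos (a - b) = 1 - 2 * (sin ((a - b) / 2))\<^sup>2" using cos_double_sin[of "(a - b) / 2"] by metis
    thus ?thesis by (simp only: power_mult_distrib power2_abs) simp
  qed
  finally show ?thesis by (rule power2_eq_imp_eq) auto
qed


text \<open>
  Ray \<open>k < T S\<close> carries the copy shifted by \<open>r0 + N (k mod T)\<close>. Two points of equal radius are then
  copies of the same point on rays whose indices differ by a multiple of \<open>T\<close>, i.e. by an angle of at
  least \<open>2 \<pi> / S\<close>. The \<open>F\<close> antipodal pairs fill up the number of points; their direction
  \<open>\<pi> / (2 Z)\<close> is not parallel to any ray.
\<close>

locale rays =
  fixes I :: "'i set" and \<xi> :: "'i \<Rightarrow> nat" and Y :: "'i \<Rightarrow> real" and H :: "('i \<times> 'i) set"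
    and M T S F r0 :: nat
  assumes fin: "finite I" and I_ne: "I \<noteq> {}"
    and residues: "\<And>u v. u \<in> I \<Longrightarrow> v \<in> I \<Longrightarrow> \<xi> u mod card I = \<xi> v mod card I \<Longrightarrow> u = v"
    and \<xi>_le: "\<And>u. u \<in> I \<Longrightarrow> \<xi> u \<le> M"
    and half: "halving_pairs I (\<lambda>i. Complex (real (\<xi> i)) (Y i)) H"
    and odds: "odd T" "odd S" and r0: "S \<le> 3 * r0" and F: "F < r0"
begin

definition "N = card I"
definition "Z = T * S"
definition "J = Inl ` ({..<Z} \<times> I) \<union> Inr ` ({..<F} \<times> (UNIV :: bool set))"

text \<open>The fillers occupy the radii 1 to \<open>F\<close>, which are positive and below
  \<open>r0\<close>, hence below the radii of all copies.\<close>

fun rad :: "(nat \<times> 'i) + (nat \<times> bool) \<Rightarrow> nat" where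
  "rad (Inl (k, i)) = r0 + \<xi> i + N * (k mod T)"
| "rad (Inr (f, b)) = f + 1"

fun ang :: "(nat \<times> 'i) + (nat \<times> bool) \<Rightarrow> real" where
  "ang (Inl (k, i)) = 2 * pi * real k / real Z"
| "ang (Inr (f, b)) = pi / (2 * real Z) + (if b then pi else 0)"

fun ht :: "(nat \<times> 'i) + (nat \<times> bool) \<Rightarrow> real" where
  "ht (Inl (k, i)) = Y i"
| "ht (Inr (f, b)) = 0"

text \<open>At \<open>\<eta> = 0\<close> each copy collapses onto its ray. Distances, and signs of
  points off the ray, are computed there and carried over to small positive
  \<open>\<eta>\<close>.\<close>

definition q :: "real \<Rightarrow> (nat \<times> 'i) + (nat \<times> bool) \<Rightarrow> complex" where
  "q \<eta> x = cis (ang x) * Complex (real (rad x)) (\<eta> * ht x)"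

definition HH :: "(((nat \<times> 'i) + (nat \<times> bool)) \<times> ((nat \<times> 'i) + (nat \<times> bool))) set" where
  "HH = (\<lambda>(k, u, v). (Inl (k, u), Inl (k, v))) ` ({..<Z} \<times> H)"

lemma Z_pos: "Z > 0" and Z_odd: "odd Z" and T_pos: "T > 0" and S_pos: "S > 0"
proof -
  show "T > 0" "S > 0" using odds by (auto intro: Nat.gr0I)
  thus "Z > 0" "odd Z" using odds by (simp_all add: Z_def)
qed

lemma N_pos: "N > 0" using fin I_ne by (simp add: N_def card_gt_0_iff)

lemma finJ: "finite J" using fin by (simp add: J_def)

lemma card_J: "card J = Z * N + 2 * F"
  unfolding J_def using fin
  by (subst card_Un_disjoint) (auto simp: card_image card_cartesian_product N_def)

lemma card_HH: "card HH = Z * card H"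
  unfolding HH_def by (subst card_image) (auto simp: inj_on_def card_cartesian_product)

lemma rad_pos: "x \<in> J \<Longrightarrow> rad x > 0"
  using F by (auto simp: J_def)

lemma orient_same_ray:
  "orient (q \<eta> (Inl (k, u))) (q \<eta> (Inl (k, v))) (q \<eta> (Inl (k, w))) =
     \<eta> * orient (Complex (real (\<xi> u)) (Y u)) (Complex (real (\<xi> v)) (Y v)) (Complex (real (\<xi> w)) (Y w))"
  unfolding q_def ang.simps orient_rotate by (simp add: orient_def algebra_simps)

text \<open>At \<open>\<eta> = 0\<close> the line through two points of equal angle passes through
  the origin, so only the angle of the third point decides its side.\<close>

lemma orient_other_ray:
  assumes "ang x = ang y"
  shows "orient (q 0 x) (q 0 y) (q 0 z) = (real (rad y) - real (rad x)) * real (rad z) * sin (ang z - ang x)"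
  using assms by (simp add: q_def orient_def sin_diff algebra_simps)

lemma tendsto_q: "((\<lambda>\<eta>. q \<eta> x) \<longlongrightarrow> q 0 x) (at_right 0)"
proof -
  have "((\<lambda>\<eta>. q \<eta> x) \<longlongrightarrow> cis (ang x) * Complex (real (rad x)) (0 * ht x)) (at_right 0)"
    unfolding q_def by (intro tendsto_intros)
  thus ?thesis by (simp add: q_def)
qed

fun \<sigma> :: "(nat \<times> 'i) + (nat \<times> bool) \<Rightarrow> (nat \<times> 'i) + (nat \<times> bool) \<Rightarrow> (nat \<times> 'i) + (nat \<times> bool) \<Rightarrow> real" where
  "\<sigma> (Inl (k, u)) (Inl (l, v)) (Inl (k', w)) = (if k' = k
     then sgn (orient (Complex (real (\<xi> u)) (Y u)) (Complex (real (\<xi> v)) (Y v)) (Complex (real (\<xi> w)) (Y w)))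
     else sgn (real (\<xi> v) - real (\<xi> u)) * sgn (sin (2 * pi * (real k' - real k) / real Z)))"
| "\<sigma> (Inl (k, u)) (Inl (l, v)) (Inr (f, b)) =
     sgn (real (\<xi> v) - real (\<xi> u)) * ((if b then -1 else 1) * sgn (sin (pi / (2 * real Z) - 2 * pi * real k / real Z)))"
| "\<sigma> _ _ _ = 0"

text \<open>This is where an odd number of rays matters: no other ray is opposite to ray
  \<open>k\<close>.\<close>

lemma sin_ray_nonzero:
  assumes "k < Z" "k' < Z" "k \<noteq> k'"
  shows "sin (2 * pi * (real k' - real k) / real Z) \<noteq> 0"
proof -
  have "\<not> int Z dvd 2 * (int k' - int k)"
  proof
    assume "int Z dvd 2 * (int k' - int k)"
    moreover have "coprime (int Z) 2" using Z_odd by simp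
    ultimately have "int Z dvd int k' - int k" using coprime_dvd_mult_right_iff by blast
    hence "int Z dvd int k' - int k" "int Z dvd int k - int k'" by (simp_all add: dvd_diff_commute)
    thus False using assms zdvd_imp_le[of "int Z" "int k' - int k"] zdvd_imp_le[of "int Z" "int k - int k'"]
      by (cases "k < k'") auto
  qed
  thus ?thesis using sin_rational_nonzero[of "int Z" "2 * (int k' - int k)"] Z_pos by (simp add: mult_ac)
qed

text \<open>The angle is \<open>pi * (1 - 4 * k) / (2 * Z)\<close>, and an odd number is not
  divisible by \<open>2 * Z\<close>.\<close>

lemma sin_filler_nonzero: "sin (pi / (2 * real Z) - 2 * pi * real k / real Z) \<noteq> 0"
proof -
  have "\<not> 2 * int Z dvd 1 - 4 * int k"
  proof
    assume "2 * int Z dvd 1 - 4 * int k"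
    hence "even (1 - 4 * int k)" using dvd_mult_left by blast
    thus False by simp
  qed
  moreover have "pi / (2 * real Z) - 2 * pi * real k / real Z = pi * real_of_int (1 - 4 * int k) / real_of_int (2 * int Z)"
    using Z_pos by (simp add: field_simps)
  ultimately show ?thesis using sin_rational_nonzero[of "2 * int Z" "1 - 4 * int k"] Z_pos by simp
qed

lemma H_pair:
  assumes "(u, v) \<in> H"
  shows "u \<in> I" "v \<in> I" "u \<noteq> v" "(v, u) \<notin> H"
    "w \<in> I - {u, v} \<Longrightarrow> orient (Complex (real (\<xi> u)) (Y u)) (Complex (real (\<xi> v)) (Y v)) (Complex (real (\<xi> w)) (Y w)) \<noteq> 0"
    "(\<Sum>w\<in>I. sgn (orient (Complex (real (\<xi> u)) (Y u)) (Complex (real (\<xi> v)) (Y v)) (Complex (real (\<xi> w)) (Y w)))) = 0"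
    "real (\<xi> v) - real (\<xi> u) \<noteq> 0"
proof -
  show a: "u \<in> I" "v \<in> I" "u \<noteq> v" "(v, u) \<notin> H"
    "w \<in> I - {u, v} \<Longrightarrow> orient (Complex (real (\<xi> u)) (Y u)) (Complex (real (\<xi> v)) (Y v)) (Complex (real (\<xi> w)) (Y w)) \<noteq> 0"
    "(\<Sum>w\<in>I. sgn (orient (Complex (real (\<xi> u)) (Y u)) (Complex (real (\<xi> v)) (Y v)) (Complex (real (\<xi> w)) (Y w)))) = 0"
    using half assms unfolding halving_pairs_def by fast+
  show "real (\<xi> v) - real (\<xi> u) \<noteq> 0" using residues[of u v] a by auto
qed

text \<open>The own ray is balanced because the pair halves its copy. Every other ray counts as a
  whole and cancels under reflection, and antipodal fillers cancel each other.\<close>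

lemma sum_\<sigma>:
  assumes "(u, v) \<in> H" "k < Z"
  shows "(\<Sum>z\<in>J. \<sigma> (Inl (k, u)) (Inl (k, v)) z) = 0"
proof -
  let ?s = "\<lambda>z. \<sigma> (Inl (k, u)) (Inl (k, v)) z"
  let ?d = "sgn (real (\<xi> v) - real (\<xi> u))"
  have "(\<Sum>z\<in>J. ?s z) = (\<Sum>z\<in>Inl ` ({..<Z} \<times> I). ?s z) + (\<Sum>z\<in>Inr ` ({..<F} \<times> UNIV). ?s z)"
    unfolding J_def using fin by (intro sum.union_disjoint) auto
  also have "(\<Sum>z\<in>Inl ` ({..<Z} \<times> I). ?s z) = (\<Sum>(k', w)\<in>{..<Z} \<times> I. ?s (Inl (k', w)))"
    by (subst sum.reindex) (auto intro!: sum.cong)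
  also have "\<dots> = (\<Sum>k'<Z. \<Sum>w\<in>I. ?s (Inl (k', w)))" by (rule sum.cartesian_product [symmetric])
  also have "\<dots> = (\<Sum>k'<Z. real N * ?d * sgn (sin (2 * pi * (real k' - real k) / real Z)))"
  proof (intro sum.cong refl)
    fix k'
    show "(\<Sum>w\<in>I. ?s (Inl (k', w))) = real N * ?d * sgn (sin (2 * pi * (real k' - real k) / real Z))"
      using H_pair(6)[OF assms(1)] by (cases "k' = k") (simp_all add: N_def)
  qed
  also have "\<dots> = 0" using sgn_sin_ray_sum[OF assms(2)] by (simp add: sum_distrib_left [symmetric])
  also have "(\<Sum>z\<in>Inr ` ({..<F} \<times> UNIV). ?s z) = (\<Sum>(f, b)\<in>{..<F} \<times> UNIV. ?s (Inr (f, b)))"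
    by (subst sum.reindex) (auto intro!: sum.cong)
  also have "\<dots> = (\<Sum>f<F. \<Sum>b\<in>UNIV. ?s (Inr (f, b)))" by (rule sum.cartesian_product [symmetric])
  also have "\<dots> = 0" by (simp add: UNIV_bool)
  finally show ?thesis by simp
qed

lemma eventually_halving: "\<forall>\<^sub>F \<eta> in at_right 0. halving_pairs J (q \<eta>) HH"
proof (rule eventually_halving_pairs[OF finJ, where \<sigma> = \<sigma>])
  show "HH \<subseteq> J \<times> J" using H_pair(1,2) by (auto simp: HH_def J_def)
  fix x y assume "(x, y) \<in> HH"
  then obtain k u v where xy: "x = Inl (k, u)" "y = Inl (k, v)" "k < Z" and uv: "(u, v) \<in> H"
    by (auto simp: HH_def)
  note h = H_pair[OF uv]
  show "x \<noteq> y \<and> (y, x) \<notin> HH" using h by (auto simp: xy HH_def)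
  show "\<sigma> x y x = 0 \<and> \<sigma> x y y = 0 \<and> (\<Sum>w\<in>J. \<sigma> x y w) = 0"
    using sum_\<sigma>[OF uv xy(3)] by (simp add: xy)
  fix z assume z: "z \<in> J" "z \<noteq> x" "z \<noteq> y"
  have lim: "((\<lambda>\<eta>. orient (q \<eta> x) (q \<eta> y) (q \<eta> z)) \<longlongrightarrow> orient (q 0 x) (q 0 y) (q 0 z)) (at_right 0)"
    unfolding orient_def by (intro tendsto_intros tendsto_q)
  have far: "\<sigma> x y z \<noteq> 0 \<and> (\<forall>\<^sub>F \<eta> in at_right 0. sgn (orient (q \<eta> x) (q \<eta> y) (q \<eta> z)) = \<sigma> x y z)"
    if "sgn (orient (q 0 x) (q 0 y) (q 0 z)) = \<sigma> x y z" "\<sigma> x y z \<noteq> 0"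
  proof -
    have "orient (q 0 x) (q 0 y) (q 0 z) \<noteq> 0" using that by force
    from eventually_sgn_eq[OF lim this] show ?thesis using that by simp
  qed
  have o: "orient (q 0 x) (q 0 y) (q 0 z) = (real (\<xi> v) - real (\<xi> u)) * real (rad z) * sin (ang z - ang x)"
    using orient_other_ray[of x y z] by (simp add: xy)
  have sgr: "sgn (real (rad z)) = 1" using rad_pos[OF z(1)] by simp
  consider w where "z = Inl (k, w)" "w \<in> I - {u, v}" | k' w where "z = Inl (k', w)" "k' < Z" "k' \<noteq> k"
    | f b where "z = Inr (f, b)"
    using z xy by (auto simp: J_def)
  thus "\<sigma> x y z \<noteq> 0 \<and> (\<forall>\<^sub>F \<eta> in at_right 0. sgn (orient (q \<eta> x) (q \<eta> y) (q \<eta> z)) = \<sigma> x y z)"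
  proof cases
    case 1
    have "\<forall>\<^sub>F \<eta> :: real in at_right 0. \<eta> > 0" by (simp add: eventually_at_right_less)
    hence "\<forall>\<^sub>F \<eta> in at_right 0. sgn (orient (q \<eta> x) (q \<eta> y) (q \<eta> z)) = \<sigma> x y z"
      by eventually_elim (simp add: xy 1 orient_same_ray sgn_mult)
    thus ?thesis using h(5)[OF 1(2)] by (simp add: xy 1 sgn_zero_iff)
  next
    case 2
    have e: "ang z - ang x = 2 * pi * (real k' - real k) / real Z"
      by (simp add: 2 xy diff_divide_distrib right_diff_distrib)
    have "sgn (orient (q 0 x) (q 0 y) (q 0 z)) = \<sigma> x y z"
      unfolding o e sgn_mult sgr using 2 by (simp add: xy)
    moreover have "\<sigma> x y z \<noteq> 0"
      using h(7) sin_ray_nonzero[OF xy(3) 2(2)] 2 by (simp add: xy sgn_zero_iff)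
    ultimately show ?thesis by (rule far)
  next
    case 3
    have e: "sin (ang z - ang x) = (if b then -1 else 1) * sin (pi / (2 * real Z) - 2 * pi * real k / real Z)"
      using sin_periodic_pi[of "pi / (2 * real Z) - 2 * pi * real k / real Z"]
      by (simp add: 3 xy algebra_simps)
    have "sgn (orient (q 0 x) (q 0 y) (q 0 z)) = \<sigma> x y z"
      unfolding o e sgn_mult sgr by (simp add: xy 3)
    moreover have "\<sigma> x y z \<noteq> 0"
      using h(7) sin_filler_nonzero[of k] by (simp add: xy 3 sgn_zero_iff)
    ultimately show ?thesis by (rule far)
  qed
qed

section \<open>Distances in the degenerate configuration\<close>

lemma rad_le: "x \<in> J \<Longrightarrow> rad x \<le> r0 + M + N * T"
proof -
  assume "x \<in> J"
  moreover have "r0 + \<xi> i + N * (k mod T) \<le> r0 + M + N * T" if "i \<in> I" for k i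
    using \<xi>_le[OF that] T_pos by (intro add_mono mult_left_mono) auto
  ultimately show ?thesis using F by (auto simp: J_def)
qed

lemma norm_q0: "norm (q 0 x) = real (rad x)"
proof -
  have "Complex (real (rad x)) 0 = of_real (real (rad x))" by (simp add: complex_eq_iff)
  thus ?thesis by (simp add: q_def norm_mult)
qed

text \<open>Different radii are integers and differ by at least 1. Copies of equal radius are at
  least a chord of the regular \<open>S\<close>-gon of radius \<open>r0\<close> apart, and
  \<open>S \<le> 3 * r0\<close> makes that chord long enough.\<close>

lemma dist_q0:
  assumes x: "x \<in> J" and y: "y \<in> J" and ne: "x \<noteq> y"
  shows "1 \<le> dist (q 0 x) (q 0 y)"
proof (cases "rad x = rad y")
  case False
  have "1 \<le> \<bar>real (rad x) - real (rad y)\<bar>" using False by linarith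
  also have "\<dots> \<le> dist (q 0 x) (q 0 y)"
    using norm_triangle_ineq3[of "q 0 x" "q 0 y"] by (simp add: norm_q0 dist_norm)
  finally show ?thesis .
next
  case True
  have d: "dist (q 0 x) (q 0 y) = real (rad x) * (2 * \<bar>sin ((ang x - ang y) / 2)\<bar>)"
  proof -
    have "q 0 z = of_real (real (rad z)) * cis (ang z)" for z by (simp add: q_def complex_eq_iff)
    hence "q 0 x - q 0 y = of_real (real (rad x)) * (cis (ang x) - cis (ang y))"
      using True by (simp add: algebra_simps)
    hence "dist (q 0 x) (q 0 y) = real (rad x) * dist (cis (ang x)) (cis (ang y))"
      by (simp add: dist_norm norm_mult)
    thus ?thesis by (simp add: dist_cis)
  qed
  consider k i k' i' where "x = Inl (k, i)" "y = Inl (k', i')" "k < Z" "k' < Z" "i \<in> I" "i' \<in> I"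
    | k i f b where "x = Inl (k, i)" "y = Inr (f, b)" "f < F"
    | k i f b where "y = Inl (k, i)" "x = Inr (f, b)" "f < F"
    | f b f' b' where "x = Inr (f, b)" "y = Inr (f', b')"
    using x y by (auto simp: J_def)
  thus ?thesis
  proof cases
    case 1
    \<comment> \<open>Reduction modulo \<open>N\<close> recovers the point, since its
      \<open>\<xi>\<close> values have distinct residues; the remaining term then recovers the ray
      modulo \<open>T\<close>.\<close>
    have eq: "\<xi> i + N * (k mod T) = \<xi> i' + N * (k' mod T)" using True 1 by simp
    hence "(\<xi> i + N * (k mod T)) mod N = (\<xi> i' + N * (k' mod T)) mod N" by simp
    hence ii: "i = i'" using residues[OF 1(5,6)] by (simp add: N_def)
    hence kk: "k mod T = k' mod T" using eq N_pos by simp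
    have aux: "3 / (2 * real S) \<le> sin ((ang (Inl (a, i)) - ang (Inl (b, i))) / 2)"
      if "a < Z" "b < a" "a mod T = b mod T" for a b
    proof -
      have "T dvd a - b" using that by (simp add: mod_eq_dvd_iff_nat)
      then obtain l where l: "a - b = T * l" by blast
      hence l1: "l \<ge> 1" using that by (cases l) auto
      have "a - b < T * S" using that by (simp add: Z_def)
      hence "T * l < T * S" by (simp only: l)
      hence l2: "l < S" by (simp only: mult_less_cancel1)
      have "real a - real b = real T * real l" using l that by (simp flip: of_nat_diff of_nat_mult)
      hence "(ang (Inl (a, i)) - ang (Inl (b, i))) / 2 = pi * (real T * real l) / (real T * real S)"
        by (simp add: Z_def diff_divide_distrib [symmetric] right_diff_distrib [symmetric])
      also have "\<dots> = pi * real l / real S" using T_pos by simp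
      finally show ?thesis using sin_polygon[OF l1 l2] by simp
    qed
    have "3 / (2 * real S) \<le> \<bar>sin ((ang x - ang y) / 2)\<bar>"
    proof (cases "k' < k")
      case True
      thus ?thesis using aux[of k k'] 1 ii kk by fastforce
    next
      case False
      hence "k < k'" using ne 1 ii by auto
      moreover have "sin ((ang x - ang y) / 2) = - sin ((ang y - ang x) / 2)"
        by (simp add: sin_minus [symmetric] minus_divide_left)
      ultimately show ?thesis using aux[of k' k] 1 ii kk by fastforce
    qed
    hence "real r0 * (2 * (3 / (2 * real S))) \<le> dist (q 0 x) (q 0 y)"
      unfolding d using 1 by (intro mult_mono) auto
    moreover have "1 \<le> real r0 * (2 * (3 / (2 * real S)))"
    proof -
      have "real S \<le> 3 * real r0" using r0 by linarith
      thus ?thesis using S_pos by (simp add: field_simps)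
    qed
    ultimately show ?thesis by linarith
  next
    case 2
    thus ?thesis using True F by simp
  next
    case 3
    thus ?thesis using True F by simp
  next
    case 4
    hence "f = f'" "b \<noteq> b'" using True ne by auto
    hence "\<bar>sin ((ang x - ang y) / 2)\<bar> = 1" using 4 by (cases b; cases b') auto
    thus ?thesis unfolding d using 4 by simp
  qed
qed

lemma rays_exist:
  assumes l: "l < 1" and u: "2 * real (r0 + M + N * T) < u"
  shows "\<exists>p. halving_pairs J p HH \<and> spaced J l u p"
proof -
  have "spaced J l u (q 0)"
    unfolding spaced_def
  proof (intro ballI impI conjI)
    fix a b assume ab: "a \<in> J" "b \<in> J" "a \<noteq> b"
    show "l < dist (q 0 a) (q 0 b)" using dist_q0[OF ab] l by linarith
    have "dist (q 0 a) (q 0 b) \<le> real (rad a) + real (rad b)"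
      using norm_triangle_ineq4[of "q 0 a" "q 0 b"] by (simp add: dist_norm norm_q0)
    also have "\<dots> \<le> 2 * real (r0 + M + N * T)"
      using add_mono[OF of_nat_mono[OF rad_le[OF ab(1)]] of_nat_mono[OF rad_le[OF ab(2)]]]
      by (simp only: mult_2)
    finally show "dist (q 0 a) (q 0 b) < u" using u by linarith
  qed
  hence "\<forall>\<^sub>F \<eta> in at_right 0. spaced J l u (q \<eta>)"
    by (rule eventually_spaced[OF finJ _ tendsto_q])
  from eventually_happens'[OF _ eventually_conj[OF eventually_halving this]] show ?thesis by auto
qed

end

section \<open>Choice of parameters\<close>

lemma sgn_close: "\<bar>x - y\<bar> < \<bar>y\<bar> \<Longrightarrow> sgn x = sgn (y :: real)"
  by (auto simp: sgn_if split: if_splits)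

text \<open>The ordinates are unchanged, so the error is linear in the three rounding errors, each
  multiplied by an ordinate difference of at most \<open>2 * R\<close>.\<close>

lemma orient_perturb_Re:
  assumes "\<bar>x1 - G * (Re p + R)\<bar> \<le> N" "\<bar>x2 - G * (Re q + R)\<bar> \<le> N" "\<bar>x3 - G * (Re r + R)\<bar> \<le> N"
    and "\<bar>Im p\<bar> \<le> R" "\<bar>Im q\<bar> \<le> R" "\<bar>Im r\<bar> \<le> R"
  shows "\<bar>orient (Complex x1 (Im p)) (Complex x2 (Im q)) (Complex x3 (Im r)) - G * orient p q r\<bar> \<le> 6 * N * R"
proof -
  have bnd: "\<bar>a * (b - c)\<bar> \<le> N * (2 * R)" if "\<bar>a\<bar> \<le> N" "\<bar>b\<bar> \<le> R" "\<bar>c\<bar> \<le> R" for a b c :: real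
  proof -
    have "\<bar>b - c\<bar> \<le> 2 * R" using that by linarith
    thus ?thesis unfolding abs_mult using that(1) by (intro mult_mono) auto
  qed
  have "orient (Complex x1 (Im p)) (Complex x2 (Im q)) (Complex x3 (Im r)) - G * orient p q r =
     (x1 - G * (Re p + R)) * (Im q - Im r) + (x2 - G * (Re q + R)) * (Im r - Im p)
       + (x3 - G * (Re r + R)) * (Im p - Im q)"
    by (simp add: orient_def algebra_simps)
  thus ?thesis
    using bnd[OF assms(1,5,6)] bnd[OF assms(2,6,4)] bnd[OF assms(3,4,5)] by linarith
qed

lemma integer_config_exists:
  "\<exists>(I :: nat list set) \<xi> Y H. finite I \<and> even (card I) \<and> card I > 0 \<and> card I \<le> 2 ^ (48 * (m + 1)\<^sup>2) \<and>
     real (card H) = (4/3) ^ m / 2 * real (card I) \<and>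
     (\<forall>u\<in>I. \<forall>v\<in>I. \<xi> u mod card I = \<xi> v mod card I \<longrightarrow> u = v) \<and>
     (\<forall>u\<in>I. \<xi> u \<le> 2 ^ (48 * (m + 1)\<^sup>2)) \<and> halving_pairs I (\<lambda>i. Complex (real (\<xi> i)) (Y i)) H"
proof -
  from robust_config_exists[of m] obtain I :: "nat list set" and p H where
    I: "finite I" "even (card I)" "card I > 0" "card I \<le> 2 * 2 ^ (16 * m\<^sup>2)"
      "real (card H) = (4/3) ^ m / 2 * real (card I)" and H: "halving_pairs I p H"
    and rob': "\<forall>(u, v)\<in>H. \<forall>w\<in>I - {u, v}. 2 / 2 ^ (32 * m\<^sup>2) \<le> \<bar>orient (p u) (p v) (p w)\<bar>"
    and bound': "\<forall>w\<in>I. \<bar>Re (p w)\<bar> \<le> 4 ^ m \<and> \<bar>Im (p w)\<bar> \<le> 4 ^ m"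
    by (elim exE conjE)
  have rob: "2 / 2 ^ (32 * m\<^sup>2) \<le> \<bar>orient (p u) (p v) (p w)\<bar>" if "(u, v) \<in> H" "w \<in> I - {u, v}" for u v w
    using bspec[OF rob' that(1)] that(2) by simp
  have bound: "\<bar>Re (p w)\<bar> \<le> 4 ^ m" "\<bar>Im (p w)\<bar> \<le> 4 ^ m" if "w \<in> I" for w
    using bound' that by simp_all
  define N where "N = card I"
  define R :: real where "R = 4 ^ m"
  \<comment> \<open>Scaled by \<open>G\<close>, the margin becomes \<open>8 * N * R\<close>, which
    exceeds the rounding error \<open>6 * N * R\<close>.\<close>
  define G :: real where "G = 4 * real N * R * 2 ^ (32 * m\<^sup>2)"
  have N: "N > 0" and R: "R \<ge> 1" using I by (simp_all add: N_def R_def)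
  have G: "G > 0" using N R by (simp add: G_def)
  obtain idx where idx: "bij_betw idx I {0..<N}" using ex_bij_betw_finite_nat[OF I(1)] by (auto simp: N_def)
  define k where "k i = nat \<lfloor>G * (Re (p i) + R) / real N\<rfloor>" for i
  \<comment> \<open>Rounding down to a multiple of \<open>N\<close> and adding the index of the
    point makes the residues distinct while keeping the error within \<open>N\<close>.\<close>
  define \<xi> where "\<xi> i = N * k i + idx i" for i
  have idx_less: "idx i < N" if "i \<in> I" for i using bij_betwE[OF idx] that by auto
  have nonneg: "G * (Re (p i) + R) \<ge> 0" if "i \<in> I" for i
    using bound(1)[OF that] G by (intro mult_nonneg_nonneg) (auto simp: R_def)
  have close: "\<bar>real (\<xi> i) - G * (Re (p i) + R)\<bar> \<le> real N" if i: "i \<in> I" for i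
  proof -
    have "0 \<le> G * (Re (p i) + R) / real N" using nonneg[OF i] by simp
    hence "real (k i) \<le> G * (Re (p i) + R) / real N" "G * (Re (p i) + R) / real N < real (k i) + 1"
      unfolding k_def by linarith+
    hence "real N * real (k i) \<le> G * (Re (p i) + R)" "G * (Re (p i) + R) < real N * real (k i) + real N"
      using N by (simp_all add: field_simps)
    moreover have "real (idx i) < real N" using idx_less[OF i] by simp
    ultimately show ?thesis unfolding \<xi>_def of_nat_add of_nat_mult by linarith
  qed
  have res: "u = v" if "u \<in> I" "v \<in> I" "\<xi> u mod card I = \<xi> v mod card I" for u v
    using that idx_less[of u] idx_less[of v] bij_betw_imp_inj_on[OF idx]
    by (simp add: \<xi>_def N_def [symmetric] inj_on_def)
  have "real (\<xi> i) \<le> 2 ^ (48 * (m + 1)\<^sup>2)" if i: "i \<in> I" for i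
  proof -
    have "real (\<xi> i) \<le> G * (Re (p i) + R) + real N" using close[OF i] by linarith
    also have "\<dots> \<le> G * (2 * R) + real N * (R * R * 2 ^ (32 * m\<^sup>2))"
    proof (intro add_mono mult_left_mono)
      show "Re (p i) + R \<le> 2 * R" using bound(1)[OF i] by (simp add: R_def)
      have "1 * 1 * 1 \<le> R * R * 2 ^ (32 * m\<^sup>2)" using R by (intro mult_mono) auto
      hence "real N * 1 \<le> real N * (R * R * 2 ^ (32 * m\<^sup>2))" by (intro mult_left_mono) auto
      thus "real N \<le> real N * (R * R * 2 ^ (32 * m\<^sup>2))" by simp
    qed (use G in simp)
    also have "\<dots> = real N * (9 * (R * R) * 2 ^ (32 * m\<^sup>2))" by (simp add: G_def)
    also have "\<dots> \<le> (2 * 2 ^ (16 * m\<^sup>2)) * (9 * (R * R) * 2 ^ (32 * m\<^sup>2))"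
    proof (intro mult_right_mono)
      show "real N \<le> 2 * 2 ^ (16 * m\<^sup>2)"
        using of_nat_mono[OF I(4), where 'a = real] by (simp add: N_def)
    qed (use R in simp)
    also have "\<dots> \<le> 2 ^ 5 * 2 ^ (4 * m) * 2 ^ (48 * m\<^sup>2)"
    proof -
      have "R * R = 2 ^ (4 * m)" by (simp add: R_def power_mult power_mult_distrib [symmetric])
      moreover have "(2 :: real) ^ (48 * m\<^sup>2) = 2 ^ (16 * m\<^sup>2) * 2 ^ (32 * m\<^sup>2)"
        by (simp add: power_add [symmetric])
      ultimately show ?thesis by simp
    qed
    also have "\<dots> = 2 ^ (5 + 4 * m + 48 * m\<^sup>2)" by (simp only: power_add)
    also have "\<dots> \<le> 2 ^ (48 * (m + 1)\<^sup>2)"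
      by (intro power_increasing) (auto simp: power2_eq_square algebra_simps)
    finally show ?thesis .
  qed
  hence le: "\<xi> i \<le> 2 ^ (48 * (m + 1)\<^sup>2)" if "i \<in> I" for i
    using that by (metis of_nat_le_iff of_nat_numeral of_nat_power)
  have sg: "sgn (orient (Complex (real (\<xi> u)) (Im (p u))) (Complex (real (\<xi> v)) (Im (p v))) (Complex (real (\<xi> w)) (Im (p w))))
      = sgn (orient (p u) (p v) (p w))" if uv: "(u, v) \<in> H" and w: "w \<in> I - {u, v}" for u v w
  proof -
    have uvw: "u \<in> I" "v \<in> I" "w \<in> I" using H uv w by (auto simp: halving_pairs_def)
    let ?O = "orient (Complex (real (\<xi> u)) (Im (p u))) (Complex (real (\<xi> v)) (Im (p v))) (Complex (real (\<xi> w)) (Im (p w)))"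
    have "\<bar>?O - G * orient (p u) (p v) (p w)\<bar> \<le> 6 * real N * R"
      using bound(2) uvw by (intro orient_perturb_Re close) (auto simp: R_def)
    also have "\<dots> < 8 * real N * R" using N R by simp
    also have "\<dots> = G * (2 / 2 ^ (32 * m\<^sup>2))" by (simp add: G_def)
    also have "\<dots> \<le> G * \<bar>orient (p u) (p v) (p w)\<bar>"
      using rob[OF uv w] G by (intro mult_left_mono) auto
    also have "\<dots> = \<bar>G * orient (p u) (p v) (p w)\<bar>" using G by (simp add: abs_mult)
    finally have "sgn ?O = sgn (G * orient (p u) (p v) (p w))" by (rule sgn_close)
    thus ?thesis using G by (simp add: sgn_mult)
  qed
  have "halving_pairs I (\<lambda>i. Complex (real (\<xi> i)) (Im (p i))) H"
    unfolding halving_pairs_def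
  proof (intro conjI ballI)
    show "H \<subseteq> I \<times> I" using H by (simp add: halving_pairs_def)
    fix x assume x: "x \<in> H"
    obtain u v where uv: "x = (u, v)" by force
    note xH = x[unfolded uv]
    have h: "u \<noteq> v" "(v, u) \<notin> H" "\<And>w. w \<in> I - {u, v} \<Longrightarrow> orient (p u) (p v) (p w) \<noteq> 0"
      "(\<Sum>w\<in>I. sgn (orient (p u) (p v) (p w))) = 0"
      using H xH unfolding halving_pairs_def by fast+
    let ?O = "\<lambda>w. orient (Complex (real (\<xi> u)) (Im (p u))) (Complex (real (\<xi> v)) (Im (p v))) (Complex (real (\<xi> w)) (Im (p w)))"
    have "sgn (?O w) = sgn (orient (p u) (p v) (p w))" if "w \<in> I" for w
      using sg[OF xH, of w] that by (cases "w = u \<or> w = v") auto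
    hence "(\<Sum>w\<in>I. sgn (?O w)) = 0" using h(4) by simp
    moreover have "?O w \<noteq> 0" if "w \<in> I - {u, v}" for w
      using sg[OF xH that] h(3)[OF that] by (metis sgn_zero_iff)
    ultimately show "case x of (u, v) \<Rightarrow> u \<noteq> v \<and> (v, u) \<notin> H \<and>
       (\<forall>w\<in>I - {u, v}. orient (Complex (real (\<xi> u)) (Im (p u))) (Complex (real (\<xi> v)) (Im (p v))) (Complex (real (\<xi> w)) (Im (p w))) \<noteq> 0) \<and>
       (\<Sum>w\<in>I. sgn (orient (Complex (real (\<xi> u)) (Im (p u))) (Complex (real (\<xi> v)) (Im (p v))) (Complex (real (\<xi> w)) (Im (p w))))) = 0"
      using h(1,2) by (simp add: uv)
  qed
  moreover have "card I \<le> 2 ^ (48 * (m + 1)\<^sup>2)"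
  proof -
    have "2 * 2 ^ (16 * m\<^sup>2) = (2 :: nat) ^ (1 + 16 * m\<^sup>2)" by simp
    also have "\<dots> \<le> 2 ^ (48 * (m + 1)\<^sup>2)"
      by (intro power_increasing) (auto simp: power2_eq_square algebra_simps)
    finally show ?thesis using I(4) by linarith
  qed
  ultimately show ?thesis using I res le
    by (intro exI[of _ I] exI[of _ \<xi>] exI[of _ "\<lambda>i. Im (p i)"] exI[of _ H]) blast
qed

section \<open>Numbers of points below the threshold\<close>

lemma grid_spaced:
  assumes "n \<ge> 2"
  defines "s \<equiv> nat \<lceil>sqrt (real n)\<rceil>"
  shows "spaced {..<n} (9/10) (4 * (9/10) * sqrt (real n)) (\<lambda>j. Complex (real (j mod s)) (real (j div s)))"
  unfolding spaced_def
proof (intro ballI impI conjI)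
  have sq: "sqrt (real n) \<ge> 1" using assms by simp
  have s: "sqrt (real n) \<le> real s" "real s < sqrt (real n) + 1" "s > 0" using sq unfolding s_def by linarith+
  fix a b assume ab: "a \<in> {..<n}" "b \<in> {..<n}" "a \<noteq> b"
  let ?x = "real (a mod s) - real (b mod s)" and ?y = "real (a div s) - real (b div s)"
  have "real n \<le> real s * real s"
    using mult_mono[OF s(1) s(1)] sq by simp
  hence "n \<le> s * s" by (simp flip: of_nat_mult)
  hence div: "j div s < s" if "j < n" for j using that by (simp add: less_mult_imp_div_less)
  have diff: "\<bar>real i - real j\<bar> \<le> sqrt (real n)" if "i < s" "j < s" for i j
  proof -
    have "real i \<le> real s - 1" "real j \<le> real s - 1" using that by linarith+
    thus ?thesis using s(2) by linarith
  qed
  have d: "dist (Complex (real (a mod s)) (real (a div s))) (Complex (real (b mod s)) (real (b div s))) = cmod (Complex ?x ?y)"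
    by (simp add: dist_norm complex_diff)
  have "cmod (Complex ?x ?y) \<le> \<bar>?x\<bar> + \<bar>?y\<bar>" using cmod_le[of "Complex ?x ?y"] by simp
  also have "\<dots> \<le> sqrt (real n) + sqrt (real n)"
    using div ab s(3) by (intro add_mono diff) auto
  also have "\<dots> < 4 * (9/10) * sqrt (real n)" using sq by simp
  finally show "dist (Complex (real (a mod s)) (real (a div s))) (Complex (real (b mod s)) (real (b div s)))
      < 4 * (9/10) * sqrt (real n)" unfolding d .
  have "a mod s \<noteq> b mod s \<or> a div s \<noteq> b div s" using ab(3) by (metis div_mult_mod_eq)
  hence "1 \<le> \<bar>?x\<bar> \<or> 1 \<le> \<bar>?y\<bar>" by linarith
  hence "1 \<le> cmod (Complex ?x ?y)"
    using abs_Re_le_cmod[of "Complex ?x ?y"] abs_Im_le_cmod[of "Complex ?x ?y"] by auto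
  thus "9/10 < dist (Complex (real (a mod s)) (real (a div s))) (Complex (real (b mod s)) (real (b div s)))"
    unfolding d by linarith
qed

text \<open>A square grid is dense; with an empty set of pairs to preserve, the perturbation result
  only moves it to general position.\<close>

lemma dense_general_position_exists:
  assumes "n \<ge> 2"
  shows "\<exists>P :: plane set. finite P \<and> card P = n \<and> general_position P \<and> dense_point_set 4 P"
proof -
  have "halving_pairs {..<n} p {}" for p by (simp add: halving_pairs_def)
  from halving_lines_of_pairs[OF _ _ _ this, of "9/10"] grid_spaced[OF assms] assms
  show ?thesis by auto
qed

section \<open>Assembly of the point set for a given number of points\<close>

lemma odd_multiple_below:
  assumes "(k :: real) \<ge> 1"
  shows "\<exists>T :: nat. odd T \<and> real T \<le> k \<and> k < real T + 2"
proof -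
  define j where "j = nat \<lfloor>k\<rfloor>"
  have j: "real j \<le> k" "k < real j + 1" "j \<ge> 1" using assms unfolding j_def by linarith+
  show ?thesis
  proof (cases "odd j")
    case True
    thus ?thesis using j by (intro exI[of _ j]) auto
  next
    case False
    thus ?thesis using j by (intro exI[of _ "j - 1"]) (auto simp: of_nat_diff)
  qed
qed

lemma many_halving_lines:
  assumes n: "even n" and big: "20 * 2 ^ (48 * (m + 1)\<^sup>2) \<le> sqrt (real n)"
  shows "\<exists>P :: plane set. finite P \<and> card P = n \<and> general_position P \<and> dense_point_set 4 P \<and>
     real n * ((4/3) ^ m / 4) \<le> real (card {L. halving_line P L})"
proof -
  obtain I :: "nat list set" and \<xi> Y H where I: "finite I" "even (card I)" "card I > 0" "card I \<le> 2 ^ (48 * (m + 1)\<^sup>2)"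
     and cH: "real (card H) = (4/3) ^ m / 2 * real (card I)"
     and res: "\<forall>u\<in>I. \<forall>v\<in>I. \<xi> u mod card I = \<xi> v mod card I \<longrightarrow> u = v"
     and \<xi>: "\<forall>u\<in>I. \<xi> u \<le> 2 ^ (48 * (m + 1)\<^sup>2)"
     and H: "halving_pairs I (\<lambda>i. Complex (real (\<xi> i)) (Y i)) H"
    using integer_config_exists[of m] by force
  define M :: nat where "M = 2 ^ (48 * (m + 1)\<^sup>2)"
  define N where "N = card I"
  define r where "r = sqrt (real n)"
  have r2: "r * r = real n" by (simp add: r_def)
  have Mr: "real M \<le> r / 20" using big by (simp add: M_def r_def)
  have N: "N > 0" "real N \<le> real M" using I by (simp_all add: N_def M_def)
  have "real M \<ge> 1" by (simp add: M_def)
  hence r: "r \<ge> 20" using Mr by linarith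
  have "r / (2 * real N) \<ge> 1" using N Mr by (simp add: field_simps)
  then obtain T where T: "odd T" "real T \<le> r / (2 * real N)" "r / (2 * real N) < real T + 2"
    using odd_multiple_below by blast
  \<comment> \<open>The radial width of the \<open>T\<close> shifted copies. As
    \<open>N \<le> r / 20\<close>, rounding \<open>T\<close> to an odd number costs at most
    \<open>2 * N \<le> r / 10\<close>, so \<open>K\<close> lies between \<open>2/5 * r\<close> and
    \<open>r / 2\<close>.\<close>
  define K where "K = T * N"
  have K: "real K \<le> r / 2" "2/5 * r \<le> real K"
  proof -
    have "real T * real N \<le> r / 2" "r / 2 < (real T + 2) * real N"
      using T(2,3) N by (simp_all add: field_simps)
    thus "real K \<le> r / 2" "2/5 * r \<le> real K"
      using N Mr by (simp_all add: K_def algebra_simps)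
  qed
  have Kpos: "real K > 0" using K r by linarith
  have "real n / real K \<ge> 1"
  proof -
    have "1 * r \<le> r * r" using r by (intro mult_right_mono) auto
    thus ?thesis using K r Kpos unfolding r2 by (simp add: field_simps)
  qed
  then obtain S where S: "odd S" "real S \<le> real n / real K" "real n / real K < real S + 2"
    using odd_multiple_below by blast
  have SK: "S * K \<le> n" "n < (S + 2) * K"
  proof -
    have "real S * real K \<le> real n" "real n < (real S + 2) * real K"
      using S(2,3) Kpos by (simp_all add: field_simps)
    hence "real (S * K) \<le> real n" "real n < real ((S + 2) * K)" by (simp_all add: algebra_simps)
    thus "S * K \<le> n" "n < (S + 2) * K" by (simp_all only: of_nat_le_iff of_nat_less_iff)
  qed
  define F where "F = (n - S * K) div 2"
  \<comment> \<open>Both \<open>n\<close> and \<open>card I\<close> are even, so the missing points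
    can be supplied in antipodal pairs.\<close>
  have "even (n - S * K)" using n I(2) by (simp add: K_def N_def)
  hence F: "2 * F = n - S * K" by (simp add: F_def)
  have FK: "F < K" using F SK by (simp add: algebra_simps)
  define r0 where "r0 = nat \<lceil>r\<rceil>"
  have r0: "r \<le> real r0" "real r0 < r + 1" using r unfolding r0_def by linarith+
  interpret R: rays I \<xi> Y H M T S F r0
  proof
    show "finite I" "I \<noteq> {}" using I by auto
    show "u = v" if "u \<in> I" "v \<in> I" "\<xi> u mod card I = \<xi> v mod card I" for u v using res that by blast
    show "\<xi> u \<le> M" if "u \<in> I" for u using \<xi> that by (simp add: M_def)
    show "halving_pairs I (\<lambda>i. Complex (real (\<xi> i)) (Y i)) H" by (rule H)
    show "odd T" "odd S" by fact+
    have "real S \<le> real n / (2/5 * r)"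
      using S(2) divide_left_mono[OF K(2), of "real n"] Kpos r by simp
    also have "\<dots> = 5/2 * r" using r unfolding r2 [symmetric] by simp
    also have "\<dots> \<le> 3 * real r0" using r0 r by linarith
    finally show "S \<le> 3 * r0" by linarith
    have "real F < real r0" using FK K(1) r0(1) r by linarith
    thus "F < r0" by simp
  qed
  have cJ: "card R.J = n"
    unfolding R.card_J R.Z_def R.N_def N_def [symmetric] using F SK by (simp add: K_def mult_ac)
  \<comment> \<open>The left side is below \<open>3.1 * r + 2\<close>, hence below
    \<open>3.6 * r\<close> for \<open>r \<ge> 20\<close>. The factor 9/10 leaves room for perturbing
    distances that are at least 1.\<close>
  have "2 * real (r0 + M + R.N * T) < 4 * (9/10) * sqrt (real (card R.J))"
  proof -
    have "real (R.N * T) = real K" by (simp add: K_def R.N_def N_def)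
    hence "2 * real (r0 + M + R.N * T) = 2 * real r0 + 2 * real M + 2 * real K" by simp
    also have "\<dots> < 4 * (9/10) * r" using r0 Mr K(1) r by simp
    finally show ?thesis by (simp add: cJ r_def)
  qed
  from R.rays_exist[OF _ this, of "9/10"] obtain p where
    p: "halving_pairs R.J p R.HH" "spaced R.J (9/10) (4 * (9/10) * sqrt (real (card R.J))) p" by auto
  have "1 * r \<le> r * r" using r by (intro mult_right_mono) auto
  hence "real n \<ge> 20" using r r2 by linarith
  hence "card R.J \<ge> 2" unfolding cJ by linarith
  from halving_lines_of_pairs[OF R.finJ this _ p(1) p(2)] obtain P :: "plane set" where
    P: "finite P" "card P = n" "general_position P" "dense_point_set 4 P" "card R.HH \<le> card {L. halving_line P L}"
    unfolding cJ by auto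
  \<comment> \<open>The fillers carry no halving lines in this count; they are fewer than
    \<open>2 * K \<le> r\<close> points, at most half of all.\<close>
  have "real n / 2 \<le> real (S * K)"
  proof -
    have "20 * r \<le> r * r" using r by (intro mult_right_mono) auto
    hence "2 * real F \<le> real n / 2" using FK K(1) r r2 by linarith
    moreover have "real n = real (S * K) + 2 * real F" using F SK(1) by linarith
    ultimately show ?thesis by linarith
  qed
  hence "real n / 2 * ((4/3) ^ m / 2) \<le> real (S * K) * ((4/3) ^ m / 2)"
    by (intro mult_right_mono) auto
  also have "\<dots> = real (card R.HH)"
    unfolding R.card_HH R.Z_def of_nat_mult cH by (simp add: K_def N_def)
  also have "\<dots> \<le> real (card {L. halving_line P L})" using P(5) by simp
  finally show ?thesis using P(1-4) by (intro exI[of _ P]) simp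
qed

text \<open>The fourth power of 4/3 is 256/81, which exceeds 3 and hence
  \<open>exp 1\<close>.\<close>

lemma four_thirds_power: "exp (real m / 4) \<le> (4/3) ^ m"
proof -
  have "exp (1/4) ^ 4 = exp (1 :: real)" by (simp add: exp_of_nat_mult [symmetric])
  also have "\<dots> \<le> (4/3) ^ 4" using exp_le by (simp add: power4_eq_xxxx)
  finally have "exp (1/4) \<le> (4/3 :: real)" by (rule power_le_imp_le_base[of _ 3, simplified]) simp
  hence "exp (1/4) ^ m \<le> (4/3 :: real) ^ m" by (intro power_mono) auto
  thus ?thesis by (simp add: exp_of_nat_mult [symmetric])
qed

theorem theorem1:
  shows "\<exists>c>0::real. \<exists>n0::nat. \<forall>n::nat. even n \<and> n > 0 \<longrightarrow>
    (\<exists>P :: plane set. finite P \<and> card P = n \<and> general_position P \<and> dense_point_set 4 P \<and>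
       (n \<ge> n0 \<longrightarrow>
          real (card {L. halving_line P L}) \<ge> real n * exp (c * sqrt (ln (real n)))))"
proof (intro exI[of _ "1/96 :: real"] conjI exI[of _ "nat \<lceil>exp (57600 :: real)\<rceil>"] allI impI)
  fix n :: nat assume n: "even n \<and> n > 0"
  hence n2: "n \<ge> 2" by auto
  show "\<exists>P :: plane set. finite P \<and> card P = n \<and> general_position P \<and> dense_point_set 4 P \<and>
       (nat \<lceil>exp (57600 :: real)\<rceil> \<le> n \<longrightarrow>
          real n * exp (1/96 * sqrt (ln (real n))) \<le> real (card {L. halving_line P L}))"
  proof (cases "nat \<lceil>exp (57600 :: real)\<rceil> \<le> n")
    case False
    thus ?thesis using dense_general_position_exists[OF n2] by auto
  next
    case True
    define x where "x = sqrt (ln (real n))"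
    have "exp 57600 \<le> real n" using True by linarith
    hence "57600 \<le> ln (real n)" using n by (simp add: ln_ge_iff)
    hence "sqrt (240 * 240) \<le> x" unfolding x_def by (intro real_sqrt_le_mono) simp
    hence x: "x \<ge> 240" by simp
    have x2: "x\<^sup>2 = ln (real n)" using \<open>57600 \<le> ln (real n)\<close> by (simp add: x_def)
    \<comment> \<open>With \<open>m + 1 \<le> x / 12\<close>, the bound
      \<open>72 * (m + 1)\<^sup>2\<close> is at most \<open>x\<^sup>2 / 2\<close>, the logarithm of
      \<open>sqrt n\<close>. This is the size condition for \<open>m\<close> steps.\<close>
    define m where "m = nat \<lfloor>x / 12\<rfloor> - 1"
    have m: "real m + 1 \<le> x / 12" "x / 12 < real m + 2" using x unfolding m_def by linarith+
    have "20 * 2 ^ (48 * (m + 1)\<^sup>2) \<le> (2 :: real) ^ 5 * 2 ^ (48 * (m + 1)\<^sup>2)" by simp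
    also have "\<dots> = 2 ^ (5 + 48 * (m + 1)\<^sup>2)" by (simp only: power_add)
    also have "\<dots> \<le> 2 ^ (72 * (m + 1)\<^sup>2)"
      by (intro power_increasing) (auto simp: power2_eq_square)
    also have "\<dots> \<le> exp 1 ^ (72 * (m + 1)\<^sup>2)"
      using exp_ge_add_one_self[of "1 :: real"] by (intro power_mono) auto
    also have "\<dots> = exp (72 * (real m + 1)\<^sup>2)" by (simp add: exp_of_nat_mult [symmetric])
    also have "\<dots> \<le> exp (x\<^sup>2 / 2)"
    proof -
      have "(real m + 1)\<^sup>2 \<le> (x / 12)\<^sup>2" using m by (intro power_mono) auto
      thus ?thesis by (simp add: power_divide)
    qed
    also have "\<dots> = sqrt (real n)"
    proof -
      have "sqrt (real n) = sqrt (exp (x\<^sup>2))" using n by (simp add: x2)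
      also have "exp (x\<^sup>2) = (exp (x\<^sup>2 / 2))\<^sup>2" by (simp add: power2_eq_square exp_add [symmetric])
      finally show ?thesis by simp
    qed
    finally have big: "20 * 2 ^ (48 * (m + 1)\<^sup>2) \<le> sqrt (real n)" .
    obtain P :: "plane set" where P: "finite P" "card P = n" "general_position P" "dense_point_set 4 P"
       "real n * ((4/3) ^ m / 4) \<le> real (card {L. halving_line P L})"
      using many_halving_lines[OF _ big] n by blast
    have "(2 :: real) * 2 \<le> exp 1 * exp 1"
      using exp_ge_add_one_self[of "1 :: real"] by (intro mult_mono) auto
    hence e2: "(4 :: real) \<le> exp 2" by (simp add: exp_add [symmetric])
    \<comment> \<open>As \<open>m > x / 12 - 2\<close>, the exponent on the right exceeds
      \<open>x / 48 - 5/2\<close>. This is at least \<open>x / 96\<close> exactly when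
      \<open>x \<ge> 240\<close>, which explains the threshold
      \<open>57600 = 240\<^sup>2\<close>.\<close>
    have "exp (1/96 * x) \<le> exp (real m / 4 - 2)" using m x by simp
    also have "\<dots> = exp (real m / 4) / exp 2" by (rule exp_diff)
    also have "\<dots> \<le> (4/3) ^ m / 4" using four_thirds_power e2 by (intro frac_le) auto
    finally have "real n * exp (1/96 * x) \<le> real n * ((4/3) ^ m / 4)" by (intro mult_left_mono) auto
    hence "real n * exp (1/96 * sqrt (ln (real n))) \<le> real (card {L. halving_line P L})"
      using P(5) unfolding x_def by linarith
    thus ?thesis using P by blast
  qed
qed simp

end
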